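(* Let $X \ne \{0\}$ be a finite-dimensional real vector space, ordered by a closed cone $X_+$ with non-empty interior. For each $A \in \mathcal{L}(X)$ the following are equivalent: (i) $(e^{tA})_{t\ge0}$ is uniformly eventually positive; (ii) $(e^{tA})_{t\ge0}$ is individually eventually positive; (iii) $(e^{tA})_{t\ge0}$ is weakly eventually positive; (iv) $s(A)$ is a dominant and geometrically simple eigenvalue of $A$, the eigenspace $\ker(s(A) - A)$ is spanned by an interior point of $X_+$, and the dual eigenspace $\ker(s(A)-A')$ is spanned by an interior point of $X'_+$; (v) (iv) holds and the eigenvalue $s(A)$ of $A$ is algebraically simple.
   Context: A cone is a non-empty subset $X_+\subseteq X$ with $X_+ + X_+\subseteq X_+$, $\lambda X_+\subseteq X_+$ for $\lambda\ge 0$, and $X_+\cap(-X_+)=\{0\}$; $\operatorname{int}$ denotes topological interior. The dual cone is $X'_+ := \{x' \in X' : \langle x', x\rangle \ge 0\ \forall x\in X_+\}$, and $A'$ is the dual operator. $(e^{tA})_{t\ge0}$ is: uniformly eventually positive if there is $t_0\ge0$ with $e^{tA}x\in\operatorname{int}(X_+)$ for all $0\ne x\in X_+$ and all $t\ge t_0$; individually eventually positive if for each $0\ne x\in X_+$ there is $t_0\ge0$ with $e^{tA}x\in\operatorname{int}(X_+)$ for all $t\ge t_0$; weakly eventually positive if for each $0\ne x\in X_+$ and $0\ne x'\in X'_+$ there is $t_0\ge0$ with $\langle x', e^{tA}x\rangle>0$ for all $t\ge t_0$. Spectral notions refer to the complexification of $X$; $s(A) := \max\{\operatorname{Re}\lambda:\lambda\in\sigma(A)\}$,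 and $s(A)$ is a dominant eigenvalue if it is an eigenvalue and every other eigenvalue has strictly smaller real part. *)

theory Defs
  imports "HOL-Analysis.Analysis"
begin

definition is_cone :: "'a::real_vector set \<Rightarrow> bool" where
  "is_cone K \<longleftrightarrow> K \<noteq> {} \<and> (\<forall>x\<in>K. \<forall>y\<in>K. x + y \<in> K)
     \<and> (\<forall>x\<in>K. \<forall>c::real. c \<ge> 0 \<longrightarrow> c *\<^sub>R x \<in> K) \<and> K \<inter> uminus ` K = {0}"

definition dual_cone :: "'a::real_normed_vector set \<Rightarrow> ('a \<Rightarrow>\<^sub>L real) set" where
  "dual_cone K = {x'. \<forall>x\<in>K. blinfun_apply x' x \<ge> 0}"

definition dual_op :: "('a::real_normed_vector \<Rightarrow>\<^sub>L 'a) \<Rightarrow> ('a \<Rightarrow>\<^sub>L real) \<Rightarrow> ('a \<Rightarrow>\<^sub>L real)" where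
  "dual_op A x' = x' o\<^sub>L A"

primrec op_pow :: "('a::real_normed_vector \<Rightarrow>\<^sub>L 'a) \<Rightarrow> nat \<Rightarrow> ('a \<Rightarrow>\<^sub>L 'a)" where
  "op_pow A 0 = id_blinfun"
| "op_pow A (Suc n) = A o\<^sub>L op_pow A n"

definition op_exp :: "real \<Rightarrow> ('a::real_normed_vector \<Rightarrow>\<^sub>L 'a) \<Rightarrow> ('a \<Rightarrow>\<^sub>L 'a)" where
  "op_exp t A = (\<Sum>n. (t ^ n / fact n) *\<^sub>R op_pow A n)"

text \<open>Complexification X_C = X \<times> X (pair (u,v) stands for u + i v).\<close>
definition cplx_op :: "('a::real_normed_vector \<Rightarrow>\<^sub>L 'a) \<Rightarrow> 'a \<times> 'a \<Rightarrow> 'a \<times> 'a" where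
  "cplx_op A w = (blinfun_apply A (fst w), blinfun_apply A (snd w))"

definition cmul :: "complex \<Rightarrow> 'a::real_vector \<times> 'a \<Rightarrow> 'a \<times> 'a" where
  "cmul z w = (Re z *\<^sub>R fst w - Im z *\<^sub>R snd w, Im z *\<^sub>R fst w + Re z *\<^sub>R snd w)"

definition gen_eigenspace_C :: "('a::real_normed_vector \<Rightarrow>\<^sub>L 'a) \<Rightarrow> complex \<Rightarrow> nat \<Rightarrow> ('a \<times> 'a) set" where
  "gen_eigenspace_C A z k = {w. ((\<lambda>w. cplx_op A w - cmul z w) ^^ k) w = 0}"

definition eigvals :: "('a::real_normed_vector \<Rightarrow>\<^sub>L 'a) \<Rightarrow> complex set" where
  "eigvals A = {z. gen_eigenspace_C A z 1 \<noteq> {0}}"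

text \<open>Complex dimensions (real dimension of a complex subspace divided by 2).\<close>
definition geom_mult :: "('a::euclidean_space \<Rightarrow>\<^sub>L 'a) \<Rightarrow> complex \<Rightarrow> nat" where
  "geom_mult A z = dim (gen_eigenspace_C A z 1) div 2"

definition alg_mult :: "('a::euclidean_space \<Rightarrow>\<^sub>L 'a) \<Rightarrow> complex \<Rightarrow> nat" where
  "alg_mult A z = dim (\<Union>k. gen_eigenspace_C A z k) div 2"

text \<open>Spectral bound s(A) (in finite dimensions the spectrum is the set of eigenvalues).\<close>
definition spectral_bound :: "('a::real_normed_vector \<Rightarrow>\<^sub>L 'a) \<Rightarrow> real" where
  "spectral_bound A = Max (Re ` eigvals A)"

definition dominant_eigenvalue :: "('a::real_normed_vector \<Rightarrow>\<^sub>L 'a) \<Rightarrow> bool" where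
  "dominant_eigenvalue A \<longleftrightarrow> complex_of_real (spectral_bound A) \<in> eigvals A
     \<and> (\<forall>z\<in>eigvals A. z \<noteq> complex_of_real (spectral_bound A) \<longrightarrow> Re z < spectral_bound A)"

definition unif_ev_pos :: "'a::real_normed_vector set \<Rightarrow> ('a \<Rightarrow>\<^sub>L 'a) \<Rightarrow> bool" where
  "unif_ev_pos K A \<longleftrightarrow> (\<exists>t0\<ge>0. \<forall>t\<ge>t0. \<forall>x\<in>K - {0}. blinfun_apply (op_exp t A) x \<in> interior K)"

definition indiv_ev_pos :: "'a::real_normed_vector set \<Rightarrow> ('a \<Rightarrow>\<^sub>L 'a) \<Rightarrow> bool" where
  "indiv_ev_pos K A \<longleftrightarrow> (\<forall>x\<in>K - {0}. \<exists>t0\<ge>0. \<forall>t\<ge>t0. blinfun_apply (op_exp t A) x \<in> interior K)"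

definition weak_ev_pos :: "'a::real_normed_vector set \<Rightarrow> ('a \<Rightarrow>\<^sub>L 'a) \<Rightarrow> bool" where
  "weak_ev_pos K A \<longleftrightarrow> (\<forall>x\<in>K - {0}. \<forall>x'\<in>dual_cone K - {0}. \<exists>t0\<ge>0. \<forall>t\<ge>t0.
       blinfun_apply x' (blinfun_apply (op_exp t A) x) > 0)"

definition cond_iv :: "'a::euclidean_space set \<Rightarrow> ('a \<Rightarrow>\<^sub>L 'a) \<Rightarrow> bool" where
  "cond_iv K A \<longleftrightarrow> dominant_eigenvalue A
     \<and> geom_mult A (complex_of_real (spectral_bound A)) = 1
     \<and> (\<exists>u\<in>interior K. {x. blinfun_apply A x = spectral_bound A *\<^sub>R x} = span {u})
     \<and> (\<exists>\<phi>\<in>interior (dual_cone K).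
          {\<psi>. dual_op A \<psi> = spectral_bound A *\<^sub>R \<psi>} = span {\<phi>})"

end

theory Submission
  imports Defs "HOL-Computational_Algebra.Fundamental_Theorem_Algebra"
    "HOL-Real_Asymp.Real_Asymp"
begin

text \<open>
  Put \<open>s = s(A)\<close>. Under weak eventual positivity, \<open>\<phi> (R(l) x)\<close> for \<open>l > s\<close>, where
  \<open>R(l) = (l - A)\<^sup>-\<^sup>1\<close>, is the Laplace transform of an eventually positive function of \<open>t\<close>; it is
  therefore bounded below as \<open>l\<close> decreases to \<open>s\<close>, and it blows up for a suitable choice of \<open>x\<close>
  and \<open>\<phi>\<close> because \<open>A\<close> has an eigenvalue on the line \<open>Re z = s\<close>. Hence a limit point \<open>Q\<close> of
  \<open>R(l) / \<parallel>R(l)\<parallel>\<close> is a nonzero operator mapping \<open>K\<close> into \<open>K\<close> with \<open>A Q = Q A = s Q\<close>, and it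
  yields positive eigenvectors \<open>u\<close> of \<open>A\<close> and \<open>\<psi>\<close> of the dual, which weak eventual positivity
  pushes into the interiors. If \<open>v\<close> belonged to another eigenvalue on the line, some nonzero boundary
  point \<open>u - c v\<close> of \<open>K\<close> would return to its own ray at arbitrarily late times, which is
  impossible.

  Conversely, \<open>X = span u \<oplus> ker \<psi>\<close> is an invariant decomposition, all eigenvalues on \<open>ker \<psi>\<close>
  have real part below \<open>s\<close>, and so \<open>exp (t (A - s))\<close> tends in norm to the rank one operator
  \<open>\<psi>(\<cdot>) u / \<psi>(u)\<close>, which maps \<open>K - {0}\<close> into the interior uniformly.
\<close>

section \<open>Complexification and annihilating polynomials\<close>

lemma cmul_0 [simp]: "cmul 0 w = 0" "cmul z 0 = 0"
  by (simp_all add: cmul_def zero_prod_def)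

lemma cmul_1 [simp]: "cmul 1 w = w"
  by (simp add: cmul_def)

lemma cmul_of_real: "cmul (of_real r) w = r *\<^sub>R w"
  by (simp add: cmul_def scaleR_prod_def)

lemma cmul_add_left: "cmul (y + z) w = cmul y w + cmul z w"
  by (simp add: cmul_def plus_prod_def algebra_simps)

lemma cmul_add_right: "cmul z (v + w) = cmul z v + cmul z w"
  by (simp add: cmul_def plus_prod_def algebra_simps)

lemma cmul_minus_left: "cmul (- z) w = - cmul z w"
  by (simp add: cmul_def uminus_prod_def algebra_simps)

lemma cmul_diff_left: "cmul (y - z) w = cmul y w - cmul z w"
  by (simp add: cmul_def minus_prod_def algebra_simps)

lemma cmul_scaleR: "cmul z (r *\<^sub>R w) = r *\<^sub>R cmul z w"
  by (simp add: cmul_def scaleR_prod_def algebra_simps)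

lemma cmul_mult: "cmul (y * z) w = cmul y (cmul z w)"
  by (simp add: cmul_def algebra_simps)

lemma cmul_eq_0: "cmul z w = 0 \<longleftrightarrow> z = 0 \<or> w = 0"
proof
  assume "cmul z w = 0"
  then have "cmul (inverse z * z) w = 0"
    by (simp add: cmul_mult)
  then show "z = 0 \<or> w = 0"
    by (cases "z = 0") auto
qed auto

lemma cplx_op_cmul: "cplx_op A (cmul z w) = cmul z (cplx_op A w)"
  by (simp add: cplx_op_def cmul_def blinfun.bilinear_simps)

lemma cplx_op_add: "cplx_op A (v + w) = cplx_op A v + cplx_op A w"
  by (simp add: cplx_op_def plus_prod_def blinfun.bilinear_simps)

lemma cplx_op_0 [simp]: "cplx_op A 0 = 0"
  by (simp add: cplx_op_def zero_prod_def)

lemma eigvals_iff: "z \<in> eigvals A \<longleftrightarrow> (\<exists>w. w \<noteq> 0 \<and> cplx_op A w = cmul z w)"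
  by (auto simp: eigvals_def gen_eigenspace_C_def)

lemma real_eigval: "blinfun_apply A x = r *\<^sub>R x \<Longrightarrow> x \<noteq> 0 \<Longrightarrow> complex_of_real r \<in> eigvals A"
  unfolding eigvals_iff
  by (rule exI[of _ "(x, 0)"]) (simp add: cplx_op_def cmul_of_real zero_prod_def)

text \<open>The functional calculus \<open>p(A) w\<close> as a Horner recursion: the tail of
  \<open>p\<close> acts on \<open>A w\<close>, so that most laws below follow by induction along
  \<open>pCons\<close> with \<open>w\<close> arbitrary.\<close>

definition cpoly_op :: "('a::real_normed_vector \<Rightarrow>\<^sub>L 'a) \<Rightarrow> complex poly \<Rightarrow> 'a \<times> 'a \<Rightarrow> 'a \<times> 'a" where
  "cpoly_op A p = fold_coeffs (\<lambda>a f w. cmul a w + f (cplx_op A w)) p (\<lambda>w. 0)"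

lemma cpoly_op_0 [simp]: "cpoly_op A 0 w = 0"
  by (simp add: cpoly_op_def)

lemma cpoly_op_pCons: "cpoly_op A (pCons a p) w = cmul a w + cpoly_op A p (cplx_op A w)"
  by (cases "p = 0 \<and> a = 0") (auto simp: cpoly_op_def)

lemma cpoly_op_const: "cpoly_op A [:a:] w = cmul a w"
  by (simp add: cpoly_op_pCons)

lemma cpoly_op_add_right: "cpoly_op A p (v + w) = cpoly_op A p v + cpoly_op A p w"
  by (induction p arbitrary: v w) (auto simp: cpoly_op_pCons cmul_add_right cplx_op_add)

lemma cpoly_op_0_right [simp]: "cpoly_op A p 0 = 0"
  by (induction p) (auto simp: cpoly_op_pCons)

lemma cpoly_op_cmul: "cpoly_op A p (cmul z w) = cmul z (cpoly_op A p w)"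
  by (induction p arbitrary: w)
    (auto simp: cpoly_op_pCons cmul_add_right cplx_op_cmul mult.commute simp flip: cmul_mult)

lemma cpoly_op_cplx_op: "cpoly_op A p (cplx_op A w) = cplx_op A (cpoly_op A p w)"
  by (induction p arbitrary: w) (auto simp: cpoly_op_pCons cplx_op_add cplx_op_cmul)

lemma cpoly_op_add: "cpoly_op A (p + q) w = cpoly_op A p w + cpoly_op A q w"
  by (induction p q arbitrary: w rule: poly_induct2)
    (auto simp: cpoly_op_pCons cmul_add_left algebra_simps)

lemma cpoly_op_smult: "cpoly_op A (smult a p) w = cmul a (cpoly_op A p w)"
  by (induction p arbitrary: w) (auto simp: cpoly_op_pCons cmul_add_right cmul_mult)

lemma cpoly_op_mult: "cpoly_op A (p * q) w = cpoly_op A p (cpoly_op A q w)"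
  by (induction p arbitrary: w)
    (auto simp: cpoly_op_pCons cpoly_op_add cpoly_op_smult cpoly_op_cplx_op)

lemma cpoly_op_monom: "cpoly_op A (monom a n) w = cmul a ((cplx_op A ^^ n) w)"
proof (induction n arbitrary: w)
  case 0
  then show ?case by (simp add: monom_0 cpoly_op_const)
next
  case (Suc n)
  then show ?case by (simp add: monom_Suc cpoly_op_pCons funpow_swap1)
qed

lemma cpoly_op_sum: "cpoly_op A (\<Sum>i\<in>I. p i) w = (\<Sum>i\<in>I. cpoly_op A (p i) w)"
  by (induction I rule: infinite_finite_induct) (auto simp: cpoly_op_add)

lemma cpoly_op_sum_right: "cpoly_op A p (\<Sum>i\<in>I. f i) = (\<Sum>i\<in>I. cpoly_op A p (f i))"
  by (induction I rule: infinite_finite_induct) (auto simp: cpoly_op_add_right)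

lemma cpoly_op_eigenvector:
  assumes "cplx_op A w = cmul z w"
  shows "cpoly_op A p w = cmul (poly p z) w"
  by (induction p) (auto simp: cpoly_op_pCons assms cpoly_op_cmul cmul_add_left cmul_mult)

text \<open>The vectors \<open>w, A w, A^2 w, ...\<close> up to exponent \<open>?n\<close> are one
  more than the real dimension allows to be independent; the coefficients of a dependence form
  \<open>p\<close>.\<close>

lemma annihilating_poly_vector:
  fixes A :: "'a::euclidean_space \<Rightarrow>\<^sub>L 'a"
  obtains p where "p \<noteq> 0" "cpoly_op A p w = 0"
proof -
  let ?n = "DIM('a \<times> 'a)"
  let ?f = "\<lambda>i. (cplx_op A ^^ i) w"
  show thesis
  proof (cases "inj_on ?f {..?n}")
    \<comment> \<open>Dependence is a property of sets and cannot see repeated iterates, so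
      \<open>A^i w = A^j w\<close> is treated apart, by the polynomial
      \<open>x^i - x^j\<close>.\<close>
    case False
    then obtain i j where ij: "i \<noteq> j" "?f i = ?f j"
      by (auto simp: inj_on_def)
    have "cpoly_op A (monom 1 i + monom (-1) j) w = 0"
      unfolding cpoly_op_add cpoly_op_monom using ij(2) by (simp add: cmul_minus_left)
    moreover have "coeff (monom (1::complex) i + monom (-1) j) i \<noteq> 0"
      using ij(1) by simp
    ultimately show thesis
      using that by (metis coeff_0)
  next
    case True
    then have "card (?f ` {..?n}) = ?n + 1"
      by (simp add: card_image)
    then have "dependent (?f ` {..?n})"
      by (intro dependent_biggerset) auto
    then obtain c where c: "\<exists>v\<in>?f ` {..?n}. c v \<noteq> 0" "(\<Sum>v\<in>?f ` {..?n}. c v *\<^sub>R v) = 0"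
      using dependent_finite[of "?f ` {..?n}"] by auto
    let ?p = "\<Sum>i\<le>?n. monom (complex_of_real (c (?f i))) i"
    have "cpoly_op A ?p w = (\<Sum>i\<le>?n. c (?f i) *\<^sub>R ?f i)"
      by (simp add: cpoly_op_sum cpoly_op_monom cmul_of_real)
    also have "\<dots> = 0"
      using c(2) by (simp only: sum.reindex[OF True] o_def)
    finally have "cpoly_op A ?p w = 0" .
    obtain k where k: "k \<le> ?n" "c (?f k) \<noteq> 0"
      using c(1) by auto
    have "coeff ?p k = (\<Sum>i\<le>?n. if i = k then complex_of_real (c (?f i)) else 0)"
      unfolding coeff_sum coeff_monom ..
    also have "\<dots> = complex_of_real (c (?f k))"
      using k(1) by (subst sum.delta) auto
    finally have "coeff ?p k \<noteq> 0"
      using k(2) by simp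
    then show thesis
      using that[of ?p] \<open>cpoly_op A ?p w = 0\<close> by fastforce
  qed
qed

lemma annihilating_poly:
  fixes A :: "'a::euclidean_space \<Rightarrow>\<^sub>L 'a"
  obtains p where "p \<noteq> 0" "\<And>w. cpoly_op A p w = 0"
proof -
  have "\<forall>b. \<exists>p. p \<noteq> 0 \<and> cpoly_op A p b = 0"
    by (metis annihilating_poly_vector)
  then obtain P where P: "\<And>b. P b \<noteq> 0" "\<And>b. cpoly_op A (P b) b = 0"
    by metis
  \<comment> \<open>The factors commute, so on each basis vector its own factor can be applied
    first.\<close>
  let ?p = "prod P Basis"
  have 0: "cpoly_op A ?p b = 0" if "b \<in> Basis" for b
  proof -
    have "?p = prod P (Basis - {b}) * P b"
      using that by (simp add: prod.remove mult.commute)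
    then show ?thesis
      by (simp add: cpoly_op_mult P)
  qed
  have "cpoly_op A ?p w = 0" for w
  proof -
    have "cpoly_op A ?p w = cpoly_op A ?p (\<Sum>b\<in>Basis. cmul (of_real (w \<bullet> b)) b)"
      by (simp add: cmul_of_real euclidean_representation del: Basis_prod_def)
    also have "\<dots> = 0"
      by (simp only: cpoly_op_sum_right cpoly_op_cmul) (simp add: 0 sum.neutral)
    finally show ?thesis .
  qed
  then show thesis
    using that[of ?p] P(1) by simp
qed

text \<open>Decay of the semigroup is needed both on the whole complexification and on the kernel of
  a dual eigenvector; hence statements relative to an invariant \<open>W\<close>.\<close>

definition cinvariant :: "('a::real_normed_vector \<Rightarrow>\<^sub>L 'a) \<Rightarrow> ('a \<times> 'a) set \<Rightarrow> bool" where
  "cinvariant A W \<longleftrightarrow> 0 \<in> W \<and> (\<forall>v\<in>W. \<forall>w\<in>W. v + w \<in> W) \<and> (\<forall>z. \<forall>w\<in>W. cmul z w \<in> W)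
     \<and> (\<forall>w\<in>W. cplx_op A w \<in> W)"

lemma cinvariant_cpoly_op: "cinvariant A W \<Longrightarrow> w \<in> W \<Longrightarrow> cpoly_op A p w \<in> W"
  by (induction p arbitrary: w) (auto simp: cpoly_op_pCons cinvariant_def)

text \<open>A substitute for triangularization: any vector is reached from \<open>0\<close> by
  successively inverting factors \<open>A - z\<close> with \<open>z\<close> an eigenvalue, because
  factors with \<open>z\<close> not an eigenvalue can be cancelled.\<close>

lemma triangular_induct [consumes 2, case_names zero step]:
  fixes A :: "'a::euclidean_space \<Rightarrow>\<^sub>L 'a"
  assumes W: "cinvariant A W" and "w \<in> W"
    and zero: "D 0"
    and step: "\<And>z v w. v \<in> W \<Longrightarrow> v \<noteq> 0 \<Longrightarrow> cplx_op A v = cmul z v \<Longrightarrow> w \<in> W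
      \<Longrightarrow> D (cplx_op A w - cmul z w) \<Longrightarrow> D w"
  shows "D w"
proof -
  have main: "D w" if "degree p = n" "p \<noteq> 0" "cpoly_op A p w = 0" "w \<in> W" for n p w
    using that
  proof (induction n arbitrary: p w)
    case 0
    then obtain c where "p = [:c:]"
      by (metis degree_eq_zeroE)
    then show ?case
      using 0 zero by (simp add: cpoly_op_const cmul_eq_0)
  next
    case (Suc n)
    have "\<not> constant (poly p)"
      using Suc.prems(1) by (simp add: constant_degree)
    then obtain z where "poly p z = 0"
      using fundamental_theorem_of_algebra by blast
    then obtain q where p: "p = [:-z, 1:] * q"
      by (metis poly_eq_0_iff_dvd dvdE)
    have q: "q \<noteq> 0"
      using Suc.prems(2) p mult_zero_right by metis
    have "degree p = degree [:-z, 1:] + degree q"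
      unfolding p using q by (subst degree_mult_eq) simp_all
    then have deg: "degree q = n"
      using Suc.prems(1) by simp
    \<comment> \<open>Since \<open>(A - z) ?x = 0\<close>, there are two cases: either
      \<open>?x = 0\<close> and the shorter \<open>q\<close> already annihilates \<open>w\<close>,
      or \<open>?x\<close> is an eigenvector in \<open>W\<close> for \<open>z\<close> and
      \<open>step\<close> reduces \<open>w\<close> to \<open>?v\<close>, which \<open>q\<close>
      annihilates.\<close>
    let ?v = "cplx_op A w - cmul z w" and ?x = "cpoly_op A q w"
    have lin: "cpoly_op A [:-z, 1:] y = cplx_op A y - cmul z y" for y
      by (simp add: cpoly_op_pCons cmul_minus_left)
    have x: "cplx_op A ?x - cmul z ?x = 0"
      using Suc.prems(3) unfolding p cpoly_op_mult lin .
    have qv: "cpoly_op A q ?v = 0"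
      using Suc.prems(3) unfolding p mult.commute[of _ q] cpoly_op_mult lin .
    have "cplx_op A w + cmul (-z) w \<in> W"
      using W Suc.prems(4) by (auto simp: cinvariant_def)
    then have vW: "?v \<in> W"
      by (simp add: cmul_minus_left)
    show ?case
    proof (cases "?x = 0")
      case True
      then show ?thesis
        using Suc.IH[OF deg q _ Suc.prems(4)] by simp
    next
      case False
      then show ?thesis
        using step[of ?x z w] x Suc.IH[OF deg q qv vW] Suc.prems(4)
          cinvariant_cpoly_op[OF W Suc.prems(4), of q] by simp
    qed
  qed
  obtain p where "p \<noteq> 0" "\<And>w. cpoly_op A p w = 0"
    using annihilating_poly by metis
  then show ?thesis
    using main \<open>w \<in> W\<close> by blast
qed

section \<open>Finiteness and non-emptiness of the spectrum\<close>

lemma cinvariant_UNIV: "cinvariant A UNIV"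
  by (simp add: cinvariant_def)

text \<open>Every eigenvalue is a root of an annihilating polynomial.\<close>

lemma finite_eigvals:
  fixes A :: "'a::euclidean_space \<Rightarrow>\<^sub>L 'a"
  shows "finite (eigvals A)"
proof -
  obtain p where p: "p \<noteq> 0" "\<And>w. cpoly_op A p w = 0"
    using annihilating_poly by metis
  have "eigvals A \<subseteq> {z. poly p z = 0}"
    using p(2) by (auto simp: eigvals_iff cmul_eq_0 dest!: cpoly_op_eigenvector[where p = p])
  then show ?thesis
    using poly_roots_finite[OF p(1)] finite_subset by blast
qed

text \<open>Without eigenvalues the step case of \<open>triangular_induct\<close> is vacuous, and
  every vector would be \<open>0\<close>.\<close>

lemma eigvals_nonempty:
  fixes A :: "'a::euclidean_space \<Rightarrow>\<^sub>L 'a"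
  shows "eigvals A \<noteq> {}"
proof
  assume e: "eigvals A = {}"
  have "w = 0" for w :: "'a \<times> 'a"
    using cinvariant_UNIV[of A] UNIV_I[of w]
    proof (induction rule: triangular_induct)
      case (step z v w)
      from step(2,3) have "z \<in> eigvals A"
        unfolding eigvals_iff by (intro exI conjI)
      with e show ?case by simp
    qed simp
  moreover obtain b :: 'a where "b \<in> Basis"
    using nonempty_Basis by blast
  ultimately show False
    by (metis fst_conv fst_zero nonzero_Basis)
qed

lemma Re_eigvals_le_spectral_bound:
  fixes A :: "'a::euclidean_space \<Rightarrow>\<^sub>L 'a"
  shows "z \<in> eigvals A \<Longrightarrow> Re z \<le> spectral_bound A"
  by (simp add: spectral_bound_def finite_eigvals)

lemma spectral_bound_attained:
  fixes A :: "'a::euclidean_space \<Rightarrow>\<^sub>L 'a"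
  obtains z where "z \<in> eigvals A" "Re z = spectral_bound A"
proof -
  have "Max (Re ` eigvals A) \<in> Re ` eigvals A"
    by (intro Max_in) (simp_all add: finite_eigvals eigvals_nonempty)
  then show thesis
    using that by (auto simp: spectral_bound_def)
qed

section \<open>The exponential of an operator\<close>

lemma op_pow_apply: "blinfun_apply (op_pow A n) x = (blinfun_apply A ^^ n) x"
  by (induction n) auto

lemma norm_op_pow_le: "norm (op_pow A n) \<le> norm A ^ n"
proof (induction n)
  case 0
  then show ?case by (simp add: norm_blinfun_id_le)
next
  case (Suc n)
  have "norm (op_pow A (Suc n)) \<le> norm A * norm (op_pow A n)"
    by (simp add: norm_blinfun_compose)
  also have "\<dots> \<le> norm A * norm A ^ n"
    by (intro mult_left_mono Suc) simp
  finally show ?case by simp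
qed

lemma op_exp_sums_blinfun:
  fixes A :: "'a::{real_normed_vector, banach} \<Rightarrow>\<^sub>L 'a"
  shows "(\<lambda>n. (t ^ n / fact n) *\<^sub>R op_pow A n) sums op_exp t A"
proof -
  have "summable (\<lambda>n. inverse (fact n) * (\<bar>t\<bar> * norm A) ^ n)"
    by (rule summable_exp)
  then have "summable (\<lambda>n. (t ^ n / fact n) *\<^sub>R op_pow A n)"
  proof (rule summable_comparison_test'[where N = 0])
    fix n
    have "norm ((t ^ n / fact n) *\<^sub>R op_pow A n) \<le> (\<bar>t\<bar> ^ n / fact n) * norm A ^ n"
      using norm_op_pow_le[of A n] by (simp add: power_abs mult_left_mono divide_right_mono)
    then show "norm ((t ^ n / fact n) *\<^sub>R op_pow A n) \<le> inverse (fact n) * (\<bar>t\<bar> * norm A) ^ n"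
      by (simp add: power_mult_distrib field_simps)
  qed
  then show ?thesis
    unfolding op_exp_def by (rule summable_sums)
qed

lemma op_exp_sums:
  fixes A :: "'a::{real_normed_vector, banach} \<Rightarrow>\<^sub>L 'a"
  shows "(\<lambda>n. (t ^ n / fact n) *\<^sub>R (blinfun_apply A ^^ n) x) sums blinfun_apply (op_exp t A) x"
  using bounded_linear.sums[OF blinfun.bounded_linear_left op_exp_sums_blinfun[of t A], of x]
  by (simp add: blinfun.scaleR_left op_pow_apply)

lemma op_exp_0:
  fixes A :: "'a::{real_normed_vector, banach} \<Rightarrow>\<^sub>L 'a"
  shows "blinfun_apply (op_exp 0 A) x = x"
proof -
  have "(\<lambda>n. (0 ^ n / fact n) *\<^sub>R (blinfun_apply A ^^ n) x) sums
      (\<Sum>n\<in>{0}. (0 ^ n / fact n) *\<^sub>R (blinfun_apply A ^^ n) x)"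
    by (intro sums_finite) auto
  then show ?thesis
    using sums_unique2[OF op_exp_sums[of 0 A x]] by simp
qed

lemma op_exp_apply_commute:
  fixes A :: "'a::{real_normed_vector, banach} \<Rightarrow>\<^sub>L 'a"
  shows "blinfun_apply A (blinfun_apply (op_exp t A) x) = blinfun_apply (op_exp t A) (blinfun_apply A x)"
proof -
  have "(\<lambda>n. blinfun_apply A ((t ^ n / fact n) *\<^sub>R (blinfun_apply A ^^ n) x)) sums
      blinfun_apply A (blinfun_apply (op_exp t A) x)"
    by (rule bounded_linear.sums[OF blinfun.bounded_linear_right op_exp_sums])
  then have "(\<lambda>n. (t ^ n / fact n) *\<^sub>R (blinfun_apply A ^^ n) (blinfun_apply A x)) sums
      blinfun_apply A (blinfun_apply (op_exp t A) x)"
    by (simp add: blinfun.scaleR_right funpow_swap1)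
  then show ?thesis
    using sums_unique2 op_exp_sums by blast
qed

text \<open>After a functional is applied, the exponential is a scalar power series in
  \<open>t\<close> and can be differentiated term by term; \<open>diffs\<close> of its coefficients
  amounts to replacing \<open>x\<close> by \<open>A x\<close>.\<close>

lemma op_exp_has_derivative_functional:
  fixes A :: "'a::{real_normed_vector, banach} \<Rightarrow>\<^sub>L 'a" and f :: "'a \<Rightarrow> real"
  assumes f: "bounded_linear f"
  shows "((\<lambda>t. f (blinfun_apply (op_exp t A) x)) has_real_derivative
    f (blinfun_apply (op_exp t A) (blinfun_apply A x))) (at t)"
proof -
  define c where "c = (\<lambda>x n. f ((blinfun_apply A ^^ n) x) / fact n)"
  have sums: "(\<lambda>n. c x n * t ^ n) sums f (blinfun_apply (op_exp t A) x)" for x t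
    using bounded_linear.sums[OF f op_exp_sums[of t A x]]
    by (simp add: c_def linear_cmul[OF bounded_linear.linear[OF f]] field_simps)
  have diffs: "diffs (c x) = c (blinfun_apply A x)"
    by (simp add: diffs_def c_def fun_eq_iff funpow_swap1 del: of_nat_Suc)
  have "((\<lambda>t. \<Sum>n. c x n * t ^ n) has_field_derivative (\<Sum>n. diffs (c x) n * t ^ n)) (at t)"
    by (rule termdiffs_strong_converges_everywhere) (rule sums_summable[OF sums])
  then show ?thesis
    by (simp only: diffs sums_unique[OF sums, symmetric])
qed

lemma op_exp_has_vector_derivative:
  fixes A :: "'a::euclidean_space \<Rightarrow>\<^sub>L 'a"
  shows "((\<lambda>t. blinfun_apply (op_exp t A) x) has_vector_derivative
    blinfun_apply (op_exp t A) (blinfun_apply A x)) (at t)"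
  unfolding has_vector_derivative_def
proof (rule iffD2[OF has_derivative_componentwise_within], rule ballI)
  fix i :: 'a
  have "((\<lambda>t. blinfun_apply (op_exp t A) x \<bullet> i) has_real_derivative
      blinfun_apply (op_exp t A) (blinfun_apply A x) \<bullet> i) (at t)"
    by (rule op_exp_has_derivative_functional) (rule bounded_linear_inner_left)
  then show "((\<lambda>t. blinfun_apply (op_exp t A) x \<bullet> i) has_derivative
      (\<lambda>h. (h *\<^sub>R blinfun_apply (op_exp t A) (blinfun_apply A x)) \<bullet> i)) (at t)"
    unfolding has_field_derivative_def inner_scaleR_left by (simp only: mult_commute_abs)
qed

lemma bounded_linear_cmul_left: "bounded_linear (\<lambda>z. cmul z w)"
  unfolding cmul_def
  by (intro bounded_linear_Pair bounded_linear_add bounded_linear_sub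
      bounded_linear_compose[OF bounded_linear_scaleR_left] bounded_linear_Re bounded_linear_Im)

lemma funpow_cplx_op:
  "(cplx_op A ^^ n) w = ((blinfun_apply A ^^ n) (fst w), (blinfun_apply A ^^ n) (snd w))"
  by (induction n) (auto simp: cplx_op_def)

lemma op_exp_eigenvector:
  fixes A :: "'a::{real_normed_vector, banach} \<Rightarrow>\<^sub>L 'a"
  assumes "cplx_op A w = cmul z w"
  shows "cplx_op (op_exp t A) w = cmul (exp (of_real t * z)) w"
proof -
  have pow: "(cplx_op A ^^ n) w = cmul (z ^ n) w" for n
    by (induction n) (simp_all add: cplx_op_cmul assms power_Suc2 cmul_mult del: power_Suc)
  have "(\<lambda>n. cmul ((of_real t * z) ^ n /\<^sub>R fact n) w) sums cmul (exp (of_real t * z)) w"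
    by (rule bounded_linear.sums[OF bounded_linear_cmul_left exp_converges])
  also have "(\<lambda>n. cmul ((of_real t * z) ^ n /\<^sub>R fact n) w) = (\<lambda>n. (t ^ n / fact n) *\<^sub>R (cplx_op A ^^ n) w)"
  proof
    fix n
    have "(of_real t * z) ^ n /\<^sub>R fact n = of_real (t ^ n / fact n) * z ^ n"
      by (simp add: power_mult_distrib scaleR_conv_of_real divide_inverse)
    then show "cmul ((of_real t * z) ^ n /\<^sub>R fact n) w = (t ^ n / fact n) *\<^sub>R (cplx_op A ^^ n) w"
      by (simp only: cmul_mult cmul_of_real pow)
  qed
  finally have s: "(\<lambda>n. (t ^ n / fact n) *\<^sub>R (cplx_op A ^^ n) w) sums cmul (exp (of_real t * z)) w" .
  show ?thesis
  proof (rule prod_eqI)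
    show "fst (cplx_op (op_exp t A) w) = fst (cmul (exp (of_real t * z)) w)"
      using sums_unique2[OF op_exp_sums bounded_linear.sums[OF bounded_linear_fst s,
            unfolded funpow_cplx_op fst_scaleR fst_conv]]
      by (simp add: cplx_op_def)
    show "snd (cplx_op (op_exp t A) w) = snd (cmul (exp (of_real t * z)) w)"
      using sums_unique2[OF op_exp_sums bounded_linear.sums[OF bounded_linear_snd s,
            unfolded funpow_cplx_op snd_scaleR snd_conv]]
      by (simp add: cplx_op_def)
  qed
qed

lemma op_exp_real_eigenvector:
  fixes A :: "'a::{real_normed_vector, banach} \<Rightarrow>\<^sub>L 'a"
  assumes "blinfun_apply A x = r *\<^sub>R x"
  shows "blinfun_apply (op_exp t A) x = exp (t * r) *\<^sub>R x"
proof -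
  have "cplx_op A (x, 0) = cmul (of_real r) (x, 0)"
    using assms by (simp add: cplx_op_def cmul_of_real)
  from op_exp_eigenvector[OF this, of t] show ?thesis
    by (simp add: cplx_op_def exp_of_real cmul_of_real flip: of_real_mult)
qed

lemma op_exp_left_eigenvector:
  fixes A :: "'a::{real_normed_vector, banach} \<Rightarrow>\<^sub>L 'a"
  assumes "\<And>x. blinfun_apply f (blinfun_apply A x) = r * blinfun_apply f x"
  shows "blinfun_apply f (blinfun_apply (op_exp t A) x) = exp (t * r) * blinfun_apply f x"
proof -
  have pow: "blinfun_apply f ((blinfun_apply A ^^ n) x) = r ^ n * blinfun_apply f x" for n
    by (induction n) (simp_all add: assms)
  have "(\<lambda>n. blinfun_apply f ((t ^ n / fact n) *\<^sub>R (blinfun_apply A ^^ n) x)) sums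
      blinfun_apply f (blinfun_apply (op_exp t A) x)"
    by (rule bounded_linear.sums[OF blinfun.bounded_linear_right op_exp_sums])
  moreover have "blinfun_apply f ((t ^ n / fact n) *\<^sub>R (blinfun_apply A ^^ n) x)
      = ((t * r) ^ n /\<^sub>R fact n) * blinfun_apply f x" for n
    by (simp add: blinfun.scaleR_right pow power_mult_distrib divide_inverse)
  ultimately show ?thesis
    using sums_unique2 sums_mult2[OF exp_converges[of "t * r"], of "blinfun_apply f x"] by simp
qed

section \<open>Decay of the rescaled semigroup\<close>

lemma inner_cmul_self: "w \<bullet> cmul z w = Re z * (norm w)\<^sup>2"
  by (cases w) (simp add: cmul_def power2_norm_eq_inner inner_prod_def inner_right_distrib
      inner_diff_right inner_commute algebra_simps)

text \<open>Energy estimate: \<open>u = norm y ^ 2\<close> satisfies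
  \<open>u' \<le> - a u + norm g ^ 2 / a\<close> by Young's inequality, so \<open>u\<close>
  eventually drops below every positive level.\<close>

lemma linear_ode_tendsto_0:
  fixes y :: "real \<Rightarrow> 'a::real_inner"
  assumes deriv: "\<And>t. (y has_vector_derivative (L (y t) + g t)) (at t)"
    and L: "\<And>v. v \<bullet> L v = - a * (norm v)\<^sup>2" and a: "a > 0"
    and g: "(g \<longlongrightarrow> 0) at_top"
  shows "(y \<longlongrightarrow> 0) at_top"
proof (rule tendstoI)
  fix e :: real
  assume "e > 0"
  \<comment> \<open>One half of \<open>e^2\<close> is the level to which \<open>g\<close> can still
    push \<open>u\<close>, the other half absorbs the decaying term
    \<open>exp (- a * t) * v T\<close>.\<close>
  define \<epsilon> where "\<epsilon> = e\<^sup>2 / 2"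
  have \<epsilon>: "\<epsilon> > 0"
    using \<open>e > 0\<close> by (simp add: \<epsilon>_def)
  define u where "u = (\<lambda>t. y t \<bullet> y t)"
  have "((\<lambda>t. (norm (g t))\<^sup>2) \<longlongrightarrow> 0) at_top"
    using tendsto_power[OF tendsto_norm[OF g], of 2] by simp
  then have "\<forall>\<^sub>F t in at_top. (norm (g t))\<^sup>2 < a\<^sup>2 * \<epsilon>"
    by (rule order_tendstoD(2)) (use a \<epsilon> in simp)
  then obtain T where T: "\<And>t. t \<ge> T \<Longrightarrow> (norm (g t))\<^sup>2 < a\<^sup>2 * \<epsilon>"
    by (auto simp: eventually_at_top_linorder)
  have u': "(u has_real_derivative 2 * (y t \<bullet> (L (y t) + g t))) (at t)" for t
    using bounded_bilinear.has_vector_derivative[OF bounded_bilinear_inner deriv[of t] deriv[of t]]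
    by (simp add: u_def has_real_derivative_iff_has_vector_derivative inner_commute)
  \<comment> \<open>From \<open>T\<close> on, \<open>u' \<le> - a (u - \<epsilon>)\<close>; with the
    integrating factor this says that \<open>v\<close> does not increase.\<close>
  define v where "v = (\<lambda>t. exp (a * t) * (u t - \<epsilon>))"
  have v': "(v has_real_derivative exp (a * t) * (a * (u t - \<epsilon>) + 2 * (y t \<bullet> (L (y t) + g t)))) (at t)" for t
    unfolding v_def by (auto intro!: derivative_eq_intros u' simp: algebra_simps)
  have v_dec: "v t \<le> v T" if "t \<ge> T" for t
  proof (rule DERIV_nonpos_imp_nonincreasing[OF that])
    fix s assume "T \<le> s"
    have "a * (2 * (y s \<bullet> g s)) \<le> a\<^sup>2 * u s + (norm (g s))\<^sup>2"
    proof -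
      have "0 \<le> (norm (a *\<^sub>R y s - g s))\<^sup>2"
        by simp
      also have "\<dots> = a\<^sup>2 * u s - a * (2 * (y s \<bullet> g s)) + (norm (g s))\<^sup>2"
        unfolding power2_norm_eq_inner u_def
        by (simp add: inner_diff_left inner_diff_right inner_commute power2_eq_square algebra_simps)
      finally show ?thesis by simp
    qed
    also have "\<dots> \<le> a\<^sup>2 * u s + a\<^sup>2 * \<epsilon>"
      using T[OF \<open>T \<le> s\<close>] by simp
    finally have "a * (2 * (y s \<bullet> g s)) \<le> a * (a * u s + a * \<epsilon>)"
      by (simp add: power2_eq_square algebra_simps)
    then have "2 * (y s \<bullet> g s) \<le> a * u s + a * \<epsilon>"
      using a by (simp only: mult_le_cancel_left_pos)
    then have "a * (u s - \<epsilon>) + 2 * (y s \<bullet> (L (y s) + g s)) \<le> 0"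
      by (simp add: inner_add_right L u_def power2_norm_eq_inner algebra_simps)
    then show "\<exists>d. (v has_real_derivative d) (at s) \<and> d \<le> 0"
      using v' by (meson exp_ge_zero mult_nonneg_nonpos)
  qed
  have "((\<lambda>t. exp (- a * t) * v T) \<longlongrightarrow> 0) at_top"
    using a by real_asymp
  then have "\<forall>\<^sub>F t in at_top. exp (- a * t) * v T < \<epsilon>"
    using \<epsilon> by (rule order_tendstoD(2))
  then show "\<forall>\<^sub>F t in at_top. dist (y t) 0 < e"
    using eventually_ge_at_top[of T]
  proof eventually_elim
    case (elim t)
    have "u t - \<epsilon> = exp (- a * t) * v t"
      by (simp add: v_def exp_minus)
    also have "\<dots> \<le> exp (- a * t) * v T"
      using v_dec[of t] elim by simp
    finally have "(norm (y t))\<^sup>2 < e\<^sup>2"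
      using elim by (simp add: u_def \<epsilon>_def power2_norm_eq_inner)
    then show ?case
      using \<open>e > 0\<close> by (simp add: power_less_imp_less_base)
  qed
qed

text \<open>Takes the place of a Jordan form: the rescaled orbit of \<open>w\<close> solves
  \<open>y' = (z - l) y + g\<close>, where \<open>g\<close> is the rescaled orbit of
  \<open>(A - z) w\<close> and tends to \<open>0\<close> by induction.\<close>

lemma op_exp_decay:
  fixes A :: "'a::euclidean_space \<Rightarrow>\<^sub>L 'a"
  assumes W: "cinvariant A W" "w \<in> W"
    and ev: "\<And>z v. v \<in> W \<Longrightarrow> v \<noteq> 0 \<Longrightarrow> cplx_op A v = cmul z v \<Longrightarrow> Re z < l"
  shows "((\<lambda>t. exp (- l * t) *\<^sub>R cplx_op (op_exp t A) w) \<longlongrightarrow> 0) at_top"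
  using W
proof (induction rule: triangular_induct)
  case zero
  then show ?case by simp
next
  case (step z v w)
  let ?y = "\<lambda>t. exp (- l * t) *\<^sub>R cplx_op (op_exp t A) w"
  let ?g = "\<lambda>t. exp (- l * t) *\<^sub>R cplx_op (op_exp t A) (cplx_op A w - cmul z w)"
  show ?case
  proof (rule linear_ode_tendsto_0[where L = "cmul (z - of_real l)" and g = ?g and a = "l - Re z"])
    fix t
    have F: "((\<lambda>t. cplx_op (op_exp t A) w) has_vector_derivative
        cplx_op (op_exp t A) (cplx_op A w)) (at t)"
      unfolding cplx_op_def fst_conv snd_conv
      by (intro has_vector_derivative_Pair op_exp_has_vector_derivative)
    have e: "((\<lambda>t. exp (- l * t)) has_real_derivative - l * exp (- l * t)) (at t)"
      by (auto intro!: derivative_eq_intros)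
    have "(?y has_vector_derivative exp (- l * t) *\<^sub>R cplx_op (op_exp t A) (cplx_op A w)
        + (- l * exp (- l * t)) *\<^sub>R cplx_op (op_exp t A) w) (at t)"
      by (rule has_vector_derivative_scaleR[OF e F])
    also have "cplx_op A w = cmul z w + (cplx_op A w - cmul z w)"
      by simp
    also have "exp (- l * t) *\<^sub>R cplx_op (op_exp t A) \<dots>
        + (- l * exp (- l * t)) *\<^sub>R cplx_op (op_exp t A) w = cmul (z - of_real l) (?y t) + ?g t"
      unfolding cplx_op_add[of _ "cmul z w"] cplx_op_cmul
      by (simp add: cmul_diff_left cmul_of_real cmul_scaleR scaleR_add_right scaleR_diff_right mult.commute[of l "exp _"])
    finally show "(?y has_vector_derivative cmul (z - of_real l) (?y t) + ?g t) (at t)" .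
  next
    \<comment> \<open>Multiplication by an imaginary number is skew for the real inner product, so
      only the real part of the scalar remains.\<close>
    show "v \<bullet> cmul (z - of_real l) v = - (l - Re z) * (norm v)\<^sup>2" for v :: "'a \<times> 'a"
      by (simp add: inner_cmul_self)
    show "0 < l - Re z"
      using ev step by simp
    show "(?g \<longlongrightarrow> 0) at_top"
      by (rule step)
  qed
qed

lemma op_exp_decay_above_spectral_bound:
  fixes A :: "'a::euclidean_space \<Rightarrow>\<^sub>L 'a"
  assumes "spectral_bound A < l"
  shows "((\<lambda>t. exp (- l * t) *\<^sub>R blinfun_apply (op_exp t A) x) \<longlongrightarrow> 0) at_top"
proof -
  have "((\<lambda>t. exp (- l * t) *\<^sub>R cplx_op (op_exp t A) (x, 0)) \<longlongrightarrow> 0) at_top"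
  proof (rule op_exp_decay[OF cinvariant_UNIV UNIV_I])
    fix z and v :: "'a \<times> 'a"
    assume "v \<noteq> 0" "cplx_op A v = cmul z v"
    then have "z \<in> eigvals A"
      unfolding eigvals_iff by (intro exI conjI)
    then show "Re z < l"
      using assms Re_eigvals_le_spectral_bound[of z A] by linarith
  qed
  from tendsto_fst[OF this] show ?thesis
    by (simp add: cplx_op_def)
qed

section \<open>Cones and dual cones\<close>

lemma cone_add: "is_cone K \<Longrightarrow> x \<in> K \<Longrightarrow> y \<in> K \<Longrightarrow> x + y \<in> K"
  and cone_scale: "is_cone K \<Longrightarrow> x \<in> K \<Longrightarrow> c \<ge> 0 \<Longrightarrow> c *\<^sub>R x \<in> K"
  by (auto simp: is_cone_def)

lemma cone_pointed:
  assumes "is_cone K" "x \<in> K" "- x \<in> K"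
  shows "x = 0"
proof -
  have "x \<in> K \<inter> uminus ` K"
    using assms(2) imageI[OF assms(3), of uminus] by simp
  moreover have "K \<inter> uminus ` K = {0}"
    using assms(1) by (simp add: is_cone_def)
  ultimately show ?thesis
    by blast
qed

lemma convex_cone_set: "is_cone K \<Longrightarrow> convex K"
  by (auto simp: convex_def intro!: cone_add cone_scale)

lemma cone_interior_scale:
  fixes K :: "'a::real_normed_vector set"
  assumes "is_cone K" "x \<in> interior K" "c > 0"
  shows "c *\<^sub>R x \<in> interior K"
proof -
  obtain r where r: "r > 0" "ball x r \<subseteq> K"
    using assms(2) by (auto simp: mem_interior)
  have "ball (c *\<^sub>R x) (c * r) \<subseteq> K"
  proof
    fix y assume y: "y \<in> ball (c *\<^sub>R x) (c * r)"
    have "c *\<^sub>R (x - y /\<^sub>R c) = c *\<^sub>R x - y"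
      using assms(3) by (simp add: scaleR_diff_right)
    then have "c * norm (x - y /\<^sub>R c) = norm (c *\<^sub>R x - y)"
      using assms(3) by (metis abs_of_pos norm_scaleR)
    then have "c * norm (x - y /\<^sub>R c) < c * r"
      using y by (simp add: dist_norm)
    then have "y /\<^sub>R c \<in> ball x r"
      using assms(3) by (simp add: dist_norm)
    then have "y /\<^sub>R c \<in> K"
      using r(2) by blast
    then have "c *\<^sub>R (y /\<^sub>R c) \<in> K"
      by (rule cone_scale[OF assms(1)]) (use assms(3) in simp)
    then show "y \<in> K"
      using assms(3) by simp
  qed
  then show ?thesis
    using r(1) assms(3) by (auto simp: mem_interior intro!: exI[of _ "c * r"])
qed

lemma cone_interior_perturb:
  fixes K :: "'a::real_normed_vector set"
  assumes "u \<in> interior K"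
  obtains e where "e > 0" "u + e *\<^sub>R x \<in> K" "u - e *\<^sub>R x \<in> K"
proof -
  obtain r where r: "r > 0" "ball u r \<subseteq> K"
    using assms by (auto simp: mem_interior)
  define e where "e = r / (norm x + 1)"
  have e: "e > 0"
    using r(1) by (simp add: e_def add_nonneg_pos)
  have "e * norm x < e * (norm x + 1)"
    using e by simp
  also have "\<dots> = r"
    by (simp add: e_def add_nonneg_eq_0_iff)
  finally have "norm (e *\<^sub>R x) < r"
    using e by simp
  then have "u + e *\<^sub>R x \<in> ball u r" "u - e *\<^sub>R x \<in> ball u r"
    by (simp_all add: dist_norm)
  then show thesis
    using that e r(2) by blast
qed

text \<open>For an interior point \<open>u\<close> and small \<open>e > 0\<close>, both
  \<open>u + e x\<close> and \<open>u\<close> lie in the cone, and their difference is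
  \<open>e x\<close>.\<close>

lemma cone_spanning:
  fixes K :: "'a::real_normed_vector set"
  assumes "is_cone K" "interior K \<noteq> {}"
  obtains y z where "y \<in> K" "z \<in> K" "x = y - z"
proof -
  obtain u where u: "u \<in> interior K"
    using assms(2) by blast
  obtain e where e: "e > 0" "u + e *\<^sub>R x \<in> K"
    using cone_interior_perturb[OF u] by metis
  have "(u + e *\<^sub>R x) /\<^sub>R e \<in> K" "u /\<^sub>R e \<in> K"
    using e u interior_subset[of K] assms(1) by (auto intro!: cone_scale)
  moreover have "x = (u + e *\<^sub>R x) /\<^sub>R e - u /\<^sub>R e"
    using e(1) by (simp add: scaleR_add_right)
  ultimately show thesis
    using that by blast
qed

lemma zero_notin_interior_cone:
  fixes K :: "'a::real_normed_vector set"
  assumes "is_cone K" "(x :: 'a) \<noteq> 0"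
  shows "0 \<notin> interior K"
proof
  assume "0 \<in> interior K"
  then obtain e where e: "e > 0" "0 + e *\<^sub>R x \<in> K" "0 - e *\<^sub>R x \<in> K"
    using cone_interior_perturb by metis
  then have "e *\<^sub>R x = 0"
    using cone_pointed[OF assms(1), of "e *\<^sub>R x"] by simp
  then show False
    using e(1) assms(2) by simp
qed

text \<open>The set of \<open>c\<close> with \<open>u - c v \<in> K\<close> is a closed nonempty proper
  subset of the line, hence it is not open.\<close>

lemma cone_boundary_on_line:
  fixes K :: "'a::real_normed_vector set"
  assumes K: "is_cone K" "closed K" and u: "u \<in> interior K" and v: "v \<notin> span {u}"
  obtains c where "u - c *\<^sub>R v \<in> K" "u - c *\<^sub>R v \<notin> interior K" "u - c *\<^sub>R v \<noteq> 0"
proof -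
  define f where "f = (\<lambda>c. u - c *\<^sub>R v)"
  have cont: "continuous_on UNIV f"
    unfolding f_def by (intro continuous_intros)
  have v0: "v \<noteq> 0"
    using v span_zero by metis
  have "\<exists>c. f c \<in> K \<and> f c \<notin> interior K"
  proof (rule ccontr)
    assume "\<not> ?thesis"
    then have "f -` K = f -` interior K"
      using interior_subset[of K] by auto
    moreover have "closed (f -` K)" "open (f -` interior K)"
      using cont K(2) by (auto intro: closed_vimage open_vimage)
    moreover have "0 \<in> f -` interior K"
      using u by (simp add: f_def)
    ultimately have "f -` K = UNIV"
      using clopen[of "f -` K"] by auto
    then have fK: "u - c *\<^sub>R v \<in> K" for c
      by (auto simp: f_def)
    \<comment> \<open>Properness: if the whole line lay in \<open>K\<close>, dividing by
      \<open>c\<close> and letting it grow along the positive integers would leave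
      \<open>- v\<close> and \<open>v\<close> in the closed cone, against pointedness.\<close>
    have "- v + u /\<^sub>R c \<in> K" "v + u /\<^sub>R c \<in> K" if "c > 0" for c
      using cone_scale[OF K(1) fK[of c], of "inverse c"] cone_scale[OF K(1) fK[of "- c"], of "inverse c"] that
      by (simp_all add: scaleR_diff_right scaleR_add_right add.commute)
    then have n: "- v + u /\<^sub>R real (Suc n) \<in> K" "v + u /\<^sub>R real (Suc n) \<in> K" for n
      by simp_all
    have lim: "(\<lambda>n. w + u /\<^sub>R real (Suc n)) \<longlonglongrightarrow> w" for w
      using tendsto_add[OF tendsto_const[of w] tendsto_scaleR[OF LIMSEQ_inverse_real_of_nat tendsto_const[of u]]]
      by simp
    have "- v \<in> K" "v \<in> K"
      by (rule closed_sequentially[OF K(2) n(1) lim], rule closed_sequentially[OF K(2) n(2) lim])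
    then show False
      using cone_pointed[OF K(1)] v0 by blast
  qed
  then obtain c where c: "u - c *\<^sub>R v \<in> K" "u - c *\<^sub>R v \<notin> interior K"
    by (auto simp: f_def)
  moreover have "u - c *\<^sub>R v \<noteq> 0"
  proof
    assume eq: "u - c *\<^sub>R v = 0"
    have "c \<noteq> 0"
      using c(2) u by auto
    then have "v = inverse c *\<^sub>R u"
      using eq by simp
    then have "v \<in> span {u}"
      by (auto simp: span_singleton)
    then show False
      using v by simp
  qed
  ultimately show thesis
    using that by blast
qed

section \<open>Duality between cone and dual cone\<close>

lemma dual_coneD: "\<phi> \<in> dual_cone K \<Longrightarrow> x \<in> K \<Longrightarrow> 0 \<le> blinfun_apply \<phi> x"
  by (simp add: dual_cone_def)

text \<open>If \<open>\<phi> u \<le> 0\<close>, nonnegativity at \<open>u + e x\<close> and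
  \<open>u - e x\<close> forces \<open>\<phi> x = 0\<close> in every direction
  \<open>x\<close>.\<close>

lemma dual_cone_pos_interior:
  assumes "\<phi> \<in> dual_cone K" "\<phi> \<noteq> 0" "u \<in> interior K"
  shows "0 < blinfun_apply \<phi> u"
proof (rule ccontr)
  assume "\<not> ?thesis"
  then have 0: "blinfun_apply \<phi> u \<le> 0"
    by simp
  have "blinfun_apply \<phi> x = 0" for x
  proof -
    obtain e where e: "e > 0" "u + e *\<^sub>R x \<in> K" "u - e *\<^sub>R x \<in> K"
      using cone_interior_perturb[OF assms(3)] by metis
    then have "0 \<le> blinfun_apply \<phi> u + e * blinfun_apply \<phi> x" "0 \<le> blinfun_apply \<phi> u - e * blinfun_apply \<phi> x"
      using dual_coneD[OF assms(1)] by (fastforce simp: blinfun.bilinear_simps)+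
    then have "e * blinfun_apply \<phi> x = 0"
      using 0 by linarith
    then show ?thesis
      using e(1) by simp
  qed
  then have "\<phi> = 0"
    by (intro blinfun_eqI) simp
  then show False
    using assms(2) by simp
qed

lemma closed_dual_cone: "closed (dual_cone K)"
proof -
  have "dual_cone K = (\<Inter>x\<in>K. {\<phi>. 0 \<le> blinfun_apply \<phi> x})"
    by (auto simp: dual_cone_def)
  then show ?thesis
    by (auto intro!: closed_INT closed_Collect_le continuous_intros)
qed

lemma is_cone_dual_cone:
  assumes "is_cone K" "interior K \<noteq> {}"
  shows "is_cone (dual_cone K)"
proof -
  have "\<phi> = 0" if "\<phi> \<in> dual_cone K" "- \<phi> \<in> dual_cone K" for \<phi>
  proof (rule ccontr)
    assume "\<phi> \<noteq> 0"
    obtain u where u: "u \<in> interior K"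
      using assms(2) by blast
    show False
      using dual_cone_pos_interior[OF that(1) \<open>\<phi> \<noteq> 0\<close> u] dual_cone_pos_interior[OF that(2) _ u] \<open>\<phi> \<noteq> 0\<close>
      by (simp add: blinfun.minus_left)
  qed
  moreover have "0 \<in> dual_cone K"
    by (simp add: dual_cone_def)
  ultimately have "dual_cone K \<inter> uminus ` dual_cone K = {0}"
    by (auto simp: image_iff)
  then show ?thesis
    using \<open>0 \<in> dual_cone K\<close> unfolding is_cone_def
    by (auto simp: dual_cone_def blinfun.bilinear_simps)
qed

text \<open>A hyperplane separates a point outside the interior from it; as the interior is
  invariant under positive scaling, the functional lies in the dual cone and is at most
  \<open>0\<close> at \<open>x\<close>.\<close>

lemma interior_cone_if_dual_pos:
  fixes K :: "'a::euclidean_space set"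
  assumes K: "is_cone K" "closed K" "interior K \<noteq> {}"
    and pos: "\<And>\<phi>. \<phi> \<in> dual_cone K \<Longrightarrow> \<phi> \<noteq> 0 \<Longrightarrow> 0 < blinfun_apply \<phi> x"
  shows "x \<in> interior K"
proof (rule ccontr)
  assume "x \<notin> interior K"
  then obtain a b where a: "a \<noteq> 0" "a \<bullet> x \<le> b" "\<And>y. y \<in> interior K \<Longrightarrow> b \<le> a \<bullet> y"
    using separating_hyperplane_sets[of "{x}" "interior K"] K convex_interior[OF convex_cone_set[OF K(1)]]
    by auto
  \<comment> \<open>Both come from scaling \<open>y\<close>: factors tending to \<open>0\<close>
    give \<open>b \<le> 0\<close>, and a negative \<open>a \<bullet> y\<close> could be scaled to
    the value \<open>b - 1\<close>.\<close>
  have ib: "b \<le> 0" "0 \<le> a \<bullet> y" if y: "y \<in> interior K" for y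
  proof -
    have ev: "b \<le> c * (a \<bullet> y)" if "c > 0" for c
      using a(3)[OF cone_interior_scale[OF K(1) y that]] by simp
    have "((\<lambda>c. c * (a \<bullet> y)) \<longlongrightarrow> 0 * (a \<bullet> y)) (at_right 0)"
      by (intro tendsto_intros)
    moreover have "\<forall>\<^sub>F c in at_right (0::real). b \<le> c * (a \<bullet> y)"
      using ev by (auto simp: eventually_at_right_field intro: exI[of _ 1])
    ultimately show "b \<le> 0"
      using tendsto_lowerbound by fastforce
    show "0 \<le> a \<bullet> y"
    proof (rule ccontr)
      assume neg: "\<not> 0 \<le> a \<bullet> y"
      have "b \<le> ((b - 1) / (a \<bullet> y)) * (a \<bullet> y)"
        using neg \<open>b \<le> 0\<close> by (intro ev) (simp add: divide_neg_neg)
      then show False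
        using neg by simp
    qed
  qed
  define \<phi> where "\<phi> = blinfun_inner_right a"
  have \<phi>: "blinfun_apply \<phi> y = a \<bullet> y" for y
    by (simp add: \<phi>_def)
  have "0 \<le> a \<bullet> y" if "y \<in> K" for y
  proof -
    have "interior K \<subseteq> {y. 0 \<le> a \<bullet> y}"
      using ib by auto
    then have "closure (interior K) \<subseteq> {y. 0 \<le> a \<bullet> y}"
      by (rule closure_minimal) (rule closed_halfspace_ge)
    then show ?thesis
      using convex_closure_interior[OF convex_cone_set[OF K(1)] K(3)] K(2) that by auto
  qed
  then have "\<phi> \<in> dual_cone K"
    by (simp add: dual_cone_def \<phi>)
  moreover have "\<phi> \<noteq> 0"
    using \<phi>[of a] a(1) by auto
  ultimately have "0 < a \<bullet> x"
    using pos[of \<phi>] \<phi> by simp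
  moreover obtain y where "y \<in> interior K"
    using K(3) by blast
  ultimately show False
    using a(2) ib(1)[of y] by simp
qed

text \<open>Adding a small multiple of an interior point makes all nonzero dual functionals strictly
  positive; the perturbed points are interior and tend to \<open>x\<close>.\<close>

lemma bipolar:
  fixes K :: "'a::euclidean_space set"
  assumes K: "is_cone K" "closed K" "interior K \<noteq> {}"
    and pos: "\<And>\<phi>. \<phi> \<in> dual_cone K \<Longrightarrow> 0 \<le> blinfun_apply \<phi> x"
  shows "x \<in> K"
proof -
  obtain u where u: "u \<in> interior K"
    using K(3) by blast
  have mem: "x + inverse (real (Suc n)) *\<^sub>R u \<in> K" for n
  proof -
    have "x + inverse (real (Suc n)) *\<^sub>R u \<in> interior K"
    proof (rule interior_cone_if_dual_pos[OF K])
      fix \<phi> assume \<phi>: "\<phi> \<in> dual_cone K" "\<phi> \<noteq> 0"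
      then show "0 < blinfun_apply \<phi> (x + inverse (real (Suc n)) *\<^sub>R u)"
        using pos[OF \<phi>(1)] dual_cone_pos_interior[OF \<phi> u]
        by (simp add: blinfun.bilinear_simps add_nonneg_pos)
    qed
    then show ?thesis
      using interior_subset by blast
  qed
  have "(\<lambda>n. x + inverse (real (Suc n)) *\<^sub>R u) \<longlonglongrightarrow> x"
    using tendsto_add[OF tendsto_const[of x] tendsto_scaleR[OF LIMSEQ_inverse_real_of_nat tendsto_const[of u]]]
    by simp
  then show ?thesis
    by (rule closed_sequentially[OF K(2) mem])
qed

text \<open>With a trivial dual cone, the interior criterion would hold vacuously at
  \<open>0\<close>.\<close>

lemma dual_cone_nontrivial:
  fixes K :: "'a::euclidean_space set"
  assumes K: "is_cone K" "closed K" "interior K \<noteq> {}"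
  obtains \<phi> where "\<phi> \<in> dual_cone K" "\<phi> \<noteq> 0"
proof -
  obtain b :: 'a where "b \<noteq> 0"
    using nonempty_Basis nonzero_Basis by blast
  then have "0 \<notin> interior K"
    using zero_notin_interior_cone[OF K(1)] by blast
  then show thesis
    using interior_cone_if_dual_pos[OF K, of 0] that by blast
qed

text \<open>\<open>\<psi>\<close> attains a positive minimum on the compact set of unit vectors of
  \<open>K\<close>; homogeneity does the rest.\<close>

lemma strictly_positive_lower_bound:
  fixes K :: "'a::euclidean_space set"
  assumes K: "is_cone K" "closed K" and pos: "\<And>x. x \<in> K \<Longrightarrow> x \<noteq> 0 \<Longrightarrow> 0 < blinfun_apply \<psi> x"
  obtains \<delta> where "\<delta> > 0" "\<And>x. x \<in> K \<Longrightarrow> \<delta> * norm x \<le> blinfun_apply \<psi> x"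
proof -
  let ?S = "K \<inter> sphere 0 1"
  have "\<exists>\<delta>>0. \<forall>x\<in>?S. \<delta> \<le> blinfun_apply \<psi> x"
  proof (cases "?S = {}")
    case True
    then show ?thesis by (intro exI[of _ 1]) simp
  next
    case False
    have "compact ?S"
      using K(2) by (intro closed_Int_compact) auto
    moreover have "continuous_on ?S (blinfun_apply \<psi>)"
      by (intro continuous_intros)
    ultimately obtain x where "x \<in> ?S" "\<forall>y\<in>?S. blinfun_apply \<psi> x \<le> blinfun_apply \<psi> y"
      using continuous_attains_inf[of ?S "blinfun_apply \<psi>"] False by blast
    then show ?thesis
      using pos[of x] by (intro exI[of _ "blinfun_apply \<psi> x"]) (auto simp flip: zero_less_norm_iff)
  qed
  then obtain \<delta> where \<delta>: "\<delta> > 0" "\<And>x. x \<in> ?S \<Longrightarrow> \<delta> \<le> blinfun_apply \<psi> x"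
    by blast
  have "\<delta> * norm x \<le> blinfun_apply \<psi> x" if "x \<in> K" for x
  proof (cases "x = 0")
    case False
    then have "x /\<^sub>R norm x \<in> ?S"
      using that by (auto intro!: cone_scale[OF K(1)])
    from \<delta>(2)[OF this] show ?thesis
      using False by (simp add: blinfun.scaleR_right field_simps)
  qed simp
  then show thesis
    using that \<delta>(1) by blast
qed

text \<open>Forwards, a small multiple of the inner product with \<open>x\<close> can be subtracted
  from \<open>\<psi>\<close>; backwards, the uniform lower bound is the radius of a ball inside the
  dual cone.\<close>

lemma interior_dual_cone_iff:
  fixes K :: "'a::euclidean_space set"
  assumes K: "is_cone K" "closed K"
  shows "\<psi> \<in> interior (dual_cone K) \<longleftrightarrow> (\<forall>x\<in>K - {0}. 0 < blinfun_apply \<psi> x)"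
proof
  assume \<psi>: "\<psi> \<in> interior (dual_cone K)"
  show "\<forall>x\<in>K - {0}. 0 < blinfun_apply \<psi> x"
  proof
    fix x assume x: "x \<in> K - {0}"
    obtain e where e: "e > 0" "\<psi> - e *\<^sub>R blinfun_inner_right x \<in> dual_cone K"
      using cone_interior_perturb[OF \<psi>] by metis
    from dual_coneD[OF e(2), of x] x have "e * (x \<bullet> x) \<le> blinfun_apply \<psi> x"
      by (simp add: blinfun.bilinear_simps)
    moreover have "0 < e * (x \<bullet> x)"
      using e(1) x by simp
    ultimately show "0 < blinfun_apply \<psi> x"
      by linarith
  qed
next
  assume "\<forall>x\<in>K - {0}. 0 < blinfun_apply \<psi> x"
  then obtain \<delta> where \<delta>: "\<delta> > 0" "\<And>x. x \<in> K \<Longrightarrow> \<delta> * norm x \<le> blinfun_apply \<psi> x"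
    using strictly_positive_lower_bound[OF K] by blast
  have "ball \<psi> \<delta> \<subseteq> dual_cone K"
  proof
    fix \<eta> assume "\<eta> \<in> ball \<psi> \<delta>"
    then have n: "norm (\<psi> - \<eta>) \<le> \<delta>"
      by (simp add: dist_norm)
    have "0 \<le> blinfun_apply \<eta> x" if "x \<in> K" for x
    proof -
      have "\<bar>blinfun_apply (\<psi> - \<eta>) x\<bar> \<le> \<delta> * norm x"
        using norm_blinfun[of "\<psi> - \<eta>" x] mult_right_mono[OF n, of "norm x"] by simp
      then show ?thesis
        using \<delta>(2)[OF that] by (simp add: blinfun.diff_left)
    qed
    then show "\<eta> \<in> dual_cone K"
      by (simp add: dual_cone_def)
  qed
  then show "\<psi> \<in> interior (dual_cone K)"
    using \<delta>(1) by (auto simp: mem_interior)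
qed

section \<open>Resolvents near the spectral bound\<close>

lemma resolvent_exists:
  fixes A :: "'a::euclidean_space \<Rightarrow>\<^sub>L 'a"
  assumes "complex_of_real l \<notin> eigvals A"
  obtains R :: "'a \<Rightarrow>\<^sub>L 'a" where
    "\<And>x. blinfun_apply R (l *\<^sub>R x - blinfun_apply A x) = x"
    "\<And>x. l *\<^sub>R blinfun_apply R x - blinfun_apply A (blinfun_apply R x) = x"
proof -
  define f where "f = (\<lambda>x. l *\<^sub>R x - blinfun_apply A x)"
  have f: "linear f"
    unfolding f_def by (rule linearI) (simp_all add: blinfun.bilinear_simps algebra_simps)
  moreover have "inj f"
  proof (rule linear_injective_0[OF f, THEN iffD2], intro allI impI)
    fix x assume "f x = 0"
    then show "x = 0"
      using real_eigval[of A x l] assms by (auto simp: f_def)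
  qed
  ultimately obtain g where g: "linear g" "\<And>x. g (f x) = x" "\<And>x. f (g x) = x"
    using linear_injective_isomorphism[of f] by blast
  then have "blinfun_apply (Blinfun g) = g"
    by (intro bounded_linear_Blinfun_apply) (simp add: linear_conv_bounded_linear)
  then show thesis
    using that[of "Blinfun g"] g by (simp add: f_def)
qed

text \<open>The quantity \<open>h T = \<phi> (R (x - exp (T (A - l)) x))\<close> is the integral
  of \<open>exp (- l t) \<phi> (exp (t A) x)\<close> over \<open>[0, T]\<close>, and \<open>\<phi> (R x)\<close> is its limit. The point is
  that \<open>C\<close> does not depend on \<open>l\<close>.\<close>

lemma resolvent_lower_bound:
  fixes A :: "'a::euclidean_space \<Rightarrow>\<^sub>L 'a"
  defines "s \<equiv> spectral_bound A"
  assumes t0: "t0 \<ge> 0" and \<kappa>: "\<kappa> \<ge> 0"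
    and lower: "\<And>t. t \<ge> t0 \<Longrightarrow> \<kappa> * exp (s * t) \<le> blinfun_apply \<phi> (blinfun_apply (op_exp t A) x)"
  obtains C where "\<And>l R. s < l \<Longrightarrow> l \<le> s + 1 \<Longrightarrow>
      (\<And>y. blinfun_apply R (l *\<^sub>R y - blinfun_apply A y) = y) \<Longrightarrow>
      \<kappa> * exp (- t0) / (l - s) - C \<le> blinfun_apply \<phi> (blinfun_apply R x)"
proof -
  define f where "f = (\<lambda>t. blinfun_apply \<phi> (blinfun_apply (op_exp t A) x))"
  have "isCont f t" for t
    unfolding f_def
    by (rule DERIV_isCont[OF op_exp_has_derivative_functional]) (rule blinfun.bounded_linear_right)
  then have "continuous_on {0..t0} f"
    by (simp add: continuous_at_imp_continuous_on)
  then have "bounded (f ` {0..t0})"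
    by (intro compact_imp_bounded compact_continuous_image) auto
  then obtain M where M: "M > 0" "\<And>t. t \<in> {0..t0} \<Longrightarrow> \<bar>f t\<bar> \<le> M"
    by (auto simp: bounded_pos)
  \<comment> \<open>Bounds the integrand on \<open>[0, t0]\<close> for all \<open>l\<close> in
    \<open>(s, s + 1]\<close> at once, because \<open>- l \<le> \<bar>s\<bar> + 1\<close>
    there.\<close>
  define B where "B = exp ((\<bar>s\<bar> + 1) * t0) * M"
  show thesis
  proof (rule that[of "t0 * B"])
    fix l and R :: "'a \<Rightarrow>\<^sub>L 'a"
    assume l: "s < l" "l \<le> s + 1"
      and R: "\<And>y. blinfun_apply R (l *\<^sub>R y - blinfun_apply A y) = y"
    define F where "F = (\<lambda>y. blinfun_apply \<phi> (blinfun_apply R y))"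
    have F: "bounded_linear F"
      unfolding F_def by (intro bounded_linear_compose[OF blinfun.bounded_linear_right blinfun.bounded_linear_right])
    define h where "h = (\<lambda>T. F x - exp (- l * T) * F (blinfun_apply (op_exp T A) x))"
    have h': "(h has_real_derivative exp (- l * T) * f T) (at T)" for T
    proof -
      have "(h has_real_derivative exp (- l * T) * (l * F (blinfun_apply (op_exp T A) x)
          - F (blinfun_apply (op_exp T A) (blinfun_apply A x)))) (at T)"
        unfolding h_def
        by (auto intro!: derivative_eq_intros op_exp_has_derivative_functional[OF F] simp: algebra_simps)
      also have "l * F (blinfun_apply (op_exp T A) x) - F (blinfun_apply (op_exp T A) (blinfun_apply A x)) = f T"
        using arg_cong[OF R[of "blinfun_apply (op_exp T A) x"], of "blinfun_apply \<phi>"]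
        by (simp add: F_def f_def blinfun.bilinear_simps op_exp_apply_commute)
      finally show ?thesis .
    qed
    have h0: "h 0 = 0"
      by (simp add: h_def op_exp_0)
    have ht0: "- (t0 * B) \<le> h t0"
    proof (cases "t0 = 0")
      case True
      then show ?thesis by (simp add: h0)
    next
      case False
      then obtain \<xi> where \<xi>: "0 < \<xi>" "\<xi> < t0" "h t0 - h 0 = (t0 - 0) * (exp (- l * \<xi>) * f \<xi>)"
        using MVT2[of 0 t0 h "\<lambda>T. exp (- l * T) * f T"] h' t0 by auto
      have "- l * \<xi> \<le> (\<bar>s\<bar> + 1) * t0"
        using l \<xi>(1,2) by (intro order_trans[OF _ mult_mono[of "- l" "\<bar>s\<bar> + 1" \<xi> t0]]) auto
      then have "exp (- l * \<xi>) * \<bar>f \<xi>\<bar> \<le> B"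
        unfolding B_def using M(2)[of \<xi>] \<xi>(1,2) by (intro mult_mono) auto
      moreover have "- (exp (- l * \<xi>) * \<bar>f \<xi>\<bar>) \<le> exp (- l * \<xi>) * f \<xi>"
        unfolding mult_minus_right[symmetric] by (intro mult_left_mono) auto
      ultimately have "- B \<le> exp (- l * \<xi>) * f \<xi>"
        by linarith
      then have "t0 * (- B) \<le> t0 * (exp (- l * \<xi>) * f \<xi>)"
        using t0 by (rule mult_left_mono)
      then show ?thesis
        using \<xi>(3) h0 by simp
    qed
    \<comment> \<open>The added term has derivative \<open>- \<kappa> exp ((s - l) T)\<close>, which
      the derivative of \<open>h\<close> outweighs after \<open>t0\<close>. So \<open>H\<close>
      increases from \<open>t0\<close> to its limit \<open>F x\<close>, as the added term vanishes
      at infinity.\<close>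
    define H where "H = (\<lambda>T. h T + \<kappa> * exp ((s - l) * T) / (l - s))"
    have H': "(H has_real_derivative exp (- l * T) * f T - \<kappa> * exp ((s - l) * T)) (at T)" for T
    proof -
      have "((\<lambda>T. \<kappa> * exp ((s - l) * T) / (l - s)) has_real_derivative
          \<kappa> * (exp ((s - l) * T) * (s - l)) / (l - s)) (at T)"
        using l(1) by (auto intro!: derivative_eq_intros)
      also have "\<kappa> * (exp ((s - l) * T) * (s - l)) / (l - s) = - (\<kappa> * exp ((s - l) * T))"
        using l(1) by (simp add: divide_eq_eq algebra_simps)
      finally show ?thesis
        unfolding H_def using DERIV_add[OF h'] by fastforce
    qed
    have "H t0 \<le> H T" if "t0 \<le> T" for T
    proof (rule DERIV_nonneg_imp_nondecreasing[OF that])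
      fix t assume "t0 \<le> t"
      have "\<kappa> * exp ((s - l) * t) = exp (- l * t) * (\<kappa> * exp (s * t))"
        by (simp add: algebra_simps flip: exp_add)
      also have "\<dots> \<le> exp (- l * t) * f t"
        using lower[OF \<open>t0 \<le> t\<close>] by (simp add: f_def)
      finally show "\<exists>d. (H has_real_derivative d) (at t) \<and> 0 \<le> d"
        using H'[of t] by (intro exI[of _ "exp (- l * t) * f t - \<kappa> * exp ((s - l) * t)"]) simp
    qed
    then have ev: "\<forall>\<^sub>F T in at_top. H t0 \<le> H T"
      using eventually_ge_at_top[of t0] by (rule eventually_mono[rotated])
    have "((\<lambda>T. exp (- l * T) *\<^sub>R blinfun_apply (op_exp T A) x) \<longlongrightarrow> 0) at_top"
      by (rule op_exp_decay_above_spectral_bound) (use l in \<open>simp add: s_def\<close>)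
    from bounded_linear.tendsto[OF F this]
    have "((\<lambda>T. exp (- l * T) * F (blinfun_apply (op_exp T A) x)) \<longlongrightarrow> 0) at_top"
      by (simp add: linear_cmul[OF bounded_linear.linear[OF F]] linear_0[OF bounded_linear.linear[OF F]])
    then have "(h \<longlongrightarrow> F x) at_top"
      unfolding h_def using tendsto_diff[OF tendsto_const[of "F x"]] by fastforce
    moreover have "((\<lambda>T. \<kappa> * exp ((s - l) * T) / (l - s)) \<longlongrightarrow> 0) at_top"
      using l(1) by real_asymp
    ultimately have "(H \<longlongrightarrow> F x) at_top"
      unfolding H_def using tendsto_add by fastforce
    then have "H t0 \<le> F x"
      using ev by (rule tendsto_lowerbound) simp
    \<comment> \<open>Here \<open>l \<le> s + 1\<close> removes \<open>l\<close> from the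
      exponent.\<close>
    moreover have "\<kappa> * exp (- t0) / (l - s) \<le> \<kappa> * exp ((s - l) * t0) / (l - s)"
    proof -
      have "- t0 \<le> (s - l) * t0"
        using mult_right_mono[of "- 1" "s - l" t0] l t0 by simp
      then show ?thesis
        using \<kappa> l(1) by (intro divide_right_mono mult_left_mono) auto
    qed
    ultimately show "\<kappa> * exp (- t0) / (l - s) - t0 * B \<le> blinfun_apply \<phi> (blinfun_apply R x)"
      using ht0 by (simp add: H_def F_def)
  qed
qed

lemma weak_ev_nonneg:
  assumes "weak_ev_pos K A" "x \<in> K" "\<phi> \<in> dual_cone K"
  shows "\<forall>\<^sub>F t in at_top. 0 \<le> blinfun_apply \<phi> (blinfun_apply (op_exp t A) x)"
proof (cases "x = 0 \<or> \<phi> = 0")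
  case False
  then have "\<exists>t0\<ge>0. \<forall>t\<ge>t0. 0 < blinfun_apply \<phi> (blinfun_apply (op_exp t A) x)"
    using assms by (auto simp: weak_ev_pos_def)
  then show ?thesis
    unfolding eventually_at_top_linorder by (meson less_imp_le)
qed auto

lemma eventually_at_top_nonneg:
  fixes P :: "real \<Rightarrow> bool"
  assumes "\<forall>\<^sub>F t in at_top. P t"
  obtains t0 where "t0 \<ge> 0" "\<And>t. t \<ge> t0 \<Longrightarrow> P t"
proof -
  obtain N where "\<And>t. t \<ge> N \<Longrightarrow> P t"
    using assms by (auto simp: eventually_at_top_linorder)
  then show thesis
    using that[of "max 0 N"] by simp
qed

text \<open>The real and imaginary parts of an eigenvector with \<open>Re z = s\<close> are differences of
  elements of \<open>K\<close>, and \<open>x\<close> is the sum of these four elements.\<close>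

lemma weak_ev_pos_growth:
  fixes K :: "'a::euclidean_space set" and A :: "'a \<Rightarrow>\<^sub>L 'a"
  assumes K: "is_cone K" "closed K" "interior K \<noteq> {}" and weak: "weak_ev_pos K A"
  obtains \<phi> x \<kappa> where "\<kappa> > 0"
    "\<forall>\<^sub>F t in at_top. \<kappa> * exp (spectral_bound A * t) \<le> blinfun_apply \<phi> (blinfun_apply (op_exp t A) x)"
proof -
  obtain z where z: "z \<in> eigvals A" "Re z = spectral_bound A"
    by (rule spectral_bound_attained)
  then obtain w where w: "w \<noteq> 0" "cplx_op A w = cmul z w"
    by (auto simp: eigvals_iff)
  \<comment> \<open>The dual cone separates points: a vector annihilated by all of it would lie in
    \<open>K\<close> together with its negative.\<close>
  have "\<exists>\<phi>\<in>dual_cone K. blinfun_apply \<phi> v \<noteq> 0" if "v \<noteq> 0" for v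
  proof (rule ccontr)
    assume "\<not> ?thesis"
    then have "v \<in> K" "- v \<in> K"
      by (auto intro!: bipolar[OF K] simp: blinfun.minus_right)
    then show False
      using cone_pointed[OF K(1)] that by blast
  qed
  moreover have "fst w \<noteq> 0 \<or> snd w \<noteq> 0"
    using w(1) by (auto simp: prod_eq_iff)
  ultimately obtain \<phi> where \<phi>: "\<phi> \<in> dual_cone K" "blinfun_apply \<phi> (fst w) \<noteq> 0 \<or> blinfun_apply \<phi> (snd w) \<noteq> 0"
    by blast
  \<comment> \<open>The complex value of \<open>\<phi>\<close> at \<open>w\<close>; along the orbit
    it is multiplied by \<open>exp (t z)\<close>, whose modulus is \<open>exp (s t)\<close>.\<close>
  define c where "c = Complex (blinfun_apply \<phi> (fst w)) (blinfun_apply \<phi> (snd w))"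
  obtain x1 x2 where x: "x1 \<in> K" "x2 \<in> K" "fst w = x1 - x2"
    using cone_spanning[OF K(1,3)] .
  obtain y1 y2 where y: "y1 \<in> K" "y2 \<in> K" "snd w = y1 - y2"
    using cone_spanning[OF K(1,3)] .
  let ?f = "\<lambda>t x. blinfun_apply \<phi> (blinfun_apply (op_exp t A) x)"
  have "\<forall>\<^sub>F t in at_top. 0 \<le> ?f t x1 \<and> 0 \<le> ?f t x2 \<and> 0 \<le> ?f t y1 \<and> 0 \<le> ?f t y2"
    using x y \<phi>(1) by (intro eventually_conj weak_ev_nonneg[OF weak])
  then have "\<forall>\<^sub>F t in at_top. cmod c * exp (spectral_bound A * t) \<le> ?f t (x1 + x2 + y1 + y2)"
  proof eventually_elim
    case (elim t)
    define E where "E = exp (of_real t * z)"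
    have "cplx_op (op_exp t A) w = cmul E w"
      unfolding E_def by (rule op_exp_eigenvector[OF w(2)])
    then have "blinfun_apply (op_exp t A) (fst w) = Re E *\<^sub>R fst w - Im E *\<^sub>R snd w"
      "blinfun_apply (op_exp t A) (snd w) = Im E *\<^sub>R fst w + Re E *\<^sub>R snd w"
      by (simp_all add: cplx_op_def cmul_def)
    then have eq: "Complex (?f t (fst w)) (?f t (snd w)) = E * c"
      by (simp add: c_def complex_eq_iff blinfun.bilinear_simps)
    have "cmod c * exp (spectral_bound A * t) = cmod (E * c)"
      by (simp add: norm_mult z(2) mult.commute E_def)
    also have "\<dots> \<le> \<bar>?f t (fst w)\<bar> + \<bar>?f t (snd w)\<bar>"
      unfolding eq[symmetric] using cmod_le[of "Complex (?f t (fst w)) (?f t (snd w))"] by simp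
    also have "\<dots> \<le> ?f t (x1 + x2 + y1 + y2)"
      using elim unfolding x(3) y(3) blinfun.add_right blinfun.diff_right by linarith
    finally show ?case .
  qed
  moreover have "cmod c > 0"
    using \<phi>(2) by (auto simp: c_def complex_eq_iff)
  ultimately show thesis
    using that by blast
qed

lemma perron_limit_operator:
  fixes K :: "'a::euclidean_space set" and A :: "'a \<Rightarrow>\<^sub>L 'a"
  assumes K: "is_cone K" "closed K" "interior K \<noteq> {}" and weak: "weak_ev_pos K A"
  obtains Q :: "'a \<Rightarrow>\<^sub>L 'a" where "Q \<noteq> 0"
    "\<And>x. blinfun_apply A (blinfun_apply Q x) = spectral_bound A *\<^sub>R blinfun_apply Q x"
    "\<And>x. blinfun_apply Q (blinfun_apply A x) = spectral_bound A *\<^sub>R blinfun_apply Q x"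
    "\<And>x. x \<in> K \<Longrightarrow> blinfun_apply Q x \<in> K"
proof -
  define s where "s = spectral_bound A"
  define l where "l = (\<lambda>n. s + inverse (real (Suc n)))"
  have l: "s < l n" "l n \<le> s + 1" for n
    by (simp_all add: l_def inverse_le_1_iff)
  have l_lim: "l \<longlonglongrightarrow> s"
    unfolding l_def using tendsto_add[OF tendsto_const[of s] LIMSEQ_inverse_real_of_nat] by simp
  have "\<exists>R. (\<forall>x. blinfun_apply R (l n *\<^sub>R x - blinfun_apply A x) = x) \<and>
      (\<forall>x. l n *\<^sub>R blinfun_apply R x - blinfun_apply A (blinfun_apply R x) = x)" for n
  proof -
    have "complex_of_real (l n) \<notin> eigvals A"
      using Re_eigvals_le_spectral_bound[of "complex_of_real (l n)" A] l(1)[of n] by (auto simp: s_def)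
    then show ?thesis
      using resolvent_exists by metis
  qed
  then obtain R where R: "\<And>n x. blinfun_apply (R n) (l n *\<^sub>R x - blinfun_apply A x) = x"
      "\<And>n x. l n *\<^sub>R blinfun_apply (R n) x - blinfun_apply A (blinfun_apply (R n) x) = x"
    by metis
  obtain \<phi>0 x0 \<kappa> where growth: "\<kappa> > 0"
      "\<forall>\<^sub>F t in at_top. \<kappa> * exp (s * t) \<le> blinfun_apply \<phi>0 (blinfun_apply (op_exp t A) x0)"
    using weak_ev_pos_growth[OF K weak] unfolding s_def .
  obtain t0 where t0: "t0 \<ge> 0"
      "\<And>t. t \<ge> t0 \<Longrightarrow> \<kappa> * exp (s * t) \<le> blinfun_apply \<phi>0 (blinfun_apply (op_exp t A) x0)"
    using eventually_at_top_nonneg[OF growth(2)] by blast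
  obtain C0 where C0: "\<kappa> * exp (- t0) / (l n - s) - C0 \<le> blinfun_apply \<phi>0 (blinfun_apply (R n) x0)" for n
    using resolvent_lower_bound[of t0 \<kappa> A \<phi>0 x0] t0 growth(1) l R(1) unfolding s_def
    by (metis less_imp_le)
  define D where "D = norm \<phi>0 * norm x0 + 1"
  have D: "D > 0"
    by (simp add: D_def add_nonneg_pos)
  \<comment> \<open>Since \<open>1 / (l n - s) = Suc n\<close>, the bound that is uniform in
    \<open>l\<close> grows linearly in \<open>n\<close>; thus the norms of the resolvents tend to
    infinity.\<close>
  have R_lower: "(\<kappa> * exp (- t0) * real (Suc n) - C0) / D \<le> norm (R n)" for n
  proof -
    have "\<kappa> * exp (- t0) * real (Suc n) - C0 \<le> blinfun_apply \<phi>0 (blinfun_apply (R n) x0)"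
      using C0[of n] by (simp add: l_def divide_inverse)
    also have "\<dots> \<le> norm \<phi>0 * norm (blinfun_apply (R n) x0)"
      using norm_blinfun[of \<phi>0 "blinfun_apply (R n) x0"] by simp
    also have "\<dots> \<le> norm \<phi>0 * (norm (R n) * norm x0)"
      by (intro mult_left_mono norm_blinfun) simp
    also have "\<dots> \<le> norm (R n) * D"
      by (simp add: D_def algebra_simps)
    finally show ?thesis
      using D by (simp add: divide_le_eq)
  qed
  have "filterlim (\<lambda>n. (\<kappa> * exp (- t0) * real (Suc n) - C0) / D) at_top sequentially"
    using growth(1) D by real_asymp
  then have R_lim: "filterlim (\<lambda>n. norm (R n)) at_top sequentially"
    by (rule filterlim_at_top_mono) (use R_lower in simp)
  have inv_lim: "(\<lambda>n. inverse (norm (R n))) \<longlonglongrightarrow> 0"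
    by (rule tendsto_inverse_0_at_top[OF R_lim])
  define q where "q = (\<lambda>n. R n /\<^sub>R norm (R n))"
  have R_nz: "R n \<noteq> 0" for n
  proof
    assume 0: "R n = 0"
    obtain b :: 'a where b: "b \<in> Basis"
      using nonempty_Basis by blast
    show False
      using R(2)[of n b] b by (simp add: 0 nonzero_Basis)
  qed
  have norm_q: "norm (q n) = 1" for n
    using R_nz[of n] by (simp add: q_def)
  \<comment> \<open>The operators form a finite-dimensional space, so a subsequence converges, and
    its limit still has norm \<open>1\<close>.\<close>
  then have "bounded (range q)"
    by (auto simp: bounded_iff intro!: exI[of _ 1])
  then obtain Q r where r: "strict_mono r" "(q \<circ> r) \<longlonglongrightarrow> Q"
    using bounded_imp_convergent_subsequence by blast
  have q_lim: "(\<lambda>n. blinfun_apply (q (r n)) x) \<longlonglongrightarrow> blinfun_apply Q x" for x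
    using blinfun.tendsto[OF r(2) tendsto_const[of x]] by (simp add: o_def)
  have lr: "(\<lambda>n. l (r n)) \<longlonglongrightarrow> s"
    using LIMSEQ_subseq_LIMSEQ[OF l_lim r(1)] by (simp add: o_def)
  have ir: "(\<lambda>n. inverse (norm (R (r n)))) \<longlonglongrightarrow> 0"
    using LIMSEQ_subseq_LIMSEQ[OF inv_lim r(1)] by (simp add: o_def)
  have rhs_lim: "(\<lambda>n. l (r n) *\<^sub>R blinfun_apply (q (r n)) x - inverse (norm (R (r n))) *\<^sub>R x)
      \<longlonglongrightarrow> s *\<^sub>R blinfun_apply Q x" for x
    using tendsto_diff[OF tendsto_scaleR[OF lr q_lim] tendsto_scaleR[OF ir tendsto_const[of x]]] by simp
  show thesis
  proof (rule that[of Q])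
    have "norm Q = 1"
      using tendsto_norm[OF r(2)] by (simp add: o_def norm_q LIMSEQ_const_iff)
    then show "Q \<noteq> 0"
      by auto
  next
    fix x
    \<comment> \<open>The resolvent identity divided by \<open>norm (R n)\<close>; the inhomogeneous
      term disappears in the limit and the eigenvalue equation remains.\<close>
    have "blinfun_apply A (blinfun_apply (q n) x) = l n *\<^sub>R blinfun_apply (q n) x - inverse (norm (R n)) *\<^sub>R x" for n
      using arg_cong[OF R(2)[of n x], of "(*\<^sub>R) (inverse (norm (R n)))"]
      by (simp add: q_def blinfun.bilinear_simps scaleR_diff_right algebra_simps)
    then have "(\<lambda>n. blinfun_apply A (blinfun_apply (q (r n)) x)) \<longlonglongrightarrow> s *\<^sub>R blinfun_apply Q x"
      using rhs_lim[of x] by simp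
    moreover have "(\<lambda>n. blinfun_apply A (blinfun_apply (q (r n)) x)) \<longlonglongrightarrow> blinfun_apply A (blinfun_apply Q x)"
      by (intro blinfun.tendsto tendsto_const q_lim)
    ultimately show "blinfun_apply A (blinfun_apply Q x) = spectral_bound A *\<^sub>R blinfun_apply Q x"
      unfolding s_def by (metis LIMSEQ_unique)
  next
    fix x
    have "blinfun_apply (q n) (blinfun_apply A x) = l n *\<^sub>R blinfun_apply (q n) x - inverse (norm (R n)) *\<^sub>R x" for n
      using arg_cong[OF R(1)[of n x], of "(*\<^sub>R) (inverse (norm (R n)))"]
      by (simp add: q_def blinfun.bilinear_simps scaleR_diff_right algebra_simps)
    then have "(\<lambda>n. blinfun_apply (q (r n)) (blinfun_apply A x)) \<longlonglongrightarrow> s *\<^sub>R blinfun_apply Q x"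
      using rhs_lim[of x] by simp
    then show "blinfun_apply Q (blinfun_apply A x) = spectral_bound A *\<^sub>R blinfun_apply Q x"
      unfolding s_def using q_lim[of "blinfun_apply A x"] by (metis LIMSEQ_unique)
  next
    fix x assume "x \<in> K"
    show "blinfun_apply Q x \<in> K"
    proof (rule bipolar[OF K])
      fix \<phi> assume "\<phi> \<in> dual_cone K"
      obtain t1 where t1: "t1 \<ge> 0" "\<And>t. t \<ge> t1 \<Longrightarrow> 0 \<le> blinfun_apply \<phi> (blinfun_apply (op_exp t A) x)"
        using eventually_at_top_nonneg[OF weak_ev_nonneg[OF weak \<open>x \<in> K\<close> \<open>\<phi> \<in> dual_cone K\<close>]] by blast
      \<comment> \<open>With \<open>\<kappa> = 0\<close> the bound is just \<open>- C\<close>,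
        independent of \<open>n\<close>; division by the exploding norm turns it into nonnegativity
        of the limit.\<close>
      obtain C where "0 * exp (- t1) / (l n - s) - C \<le> blinfun_apply \<phi> (blinfun_apply (R n) x)" for n
        using resolvent_lower_bound[of t1 0 A \<phi> x] t1 l R(1) unfolding s_def
        by (metis mult_zero_left order_refl)
      then have C: "- C \<le> blinfun_apply \<phi> (blinfun_apply (R n) x)" for n
        by simp
      have "inverse (norm (R n)) * (- C) \<le> blinfun_apply \<phi> (blinfun_apply (q n) x)" for n
        using mult_left_mono[OF C[of n], of "inverse (norm (R n))"] by (simp add: q_def blinfun.bilinear_simps)
      moreover have "(\<lambda>n. blinfun_apply \<phi> (blinfun_apply (q (r n)) x)) \<longlonglongrightarrow> blinfun_apply \<phi> (blinfun_apply Q x)"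
        by (intro blinfun.tendsto tendsto_const q_lim)
      moreover have "(\<lambda>n. inverse (norm (R (r n))) * (- C)) \<longlonglongrightarrow> 0"
        using tendsto_mult[OF ir tendsto_const[of "- C"]] by simp
      ultimately show "0 \<le> blinfun_apply \<phi> (blinfun_apply Q x)"
        by (intro LIMSEQ_le[of "\<lambda>n. inverse (norm (R (r n))) * (- C)"]) auto
    qed
  qed
qed

section \<open>Eventual positivity\<close>

text \<open>The semigroup multiplies \<open>u\<close> by positive scalars, so strict positivity at
  one late time is already strict positivity at \<open>u\<close>.\<close>

lemma weak_ev_pos_eigenvector_interior:
  fixes K :: "'a::euclidean_space set"
  assumes K: "is_cone K" "closed K" "interior K \<noteq> {}" and weak: "weak_ev_pos K A"
    and u: "u \<in> K" "u \<noteq> 0" "blinfun_apply A u = r *\<^sub>R u"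
  shows "u \<in> interior K"
proof (rule interior_cone_if_dual_pos[OF K])
  fix \<phi> assume "\<phi> \<in> dual_cone K" "\<phi> \<noteq> 0"
  then obtain t where "0 < blinfun_apply \<phi> (blinfun_apply (op_exp t A) u)"
    using weak u unfolding weak_ev_pos_def by blast
  then show "0 < blinfun_apply \<phi> u"
    by (simp add: op_exp_real_eigenvector[OF u(3)] blinfun.scaleR_right zero_less_mult_iff)
qed

lemma weak_ev_pos_dual_eigenvector_interior:
  fixes K :: "'a::euclidean_space set"
  assumes K: "is_cone K" "closed K" and weak: "weak_ev_pos K A"
    and \<psi>: "\<psi> \<in> dual_cone K" "\<psi> \<noteq> 0" "dual_op A \<psi> = r *\<^sub>R \<psi>"
  shows "\<psi> \<in> interior (dual_cone K)"
  unfolding interior_dual_cone_iff[OF K]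
proof
  fix x assume "x \<in> K - {0}"
  then obtain t where t: "0 < blinfun_apply \<psi> (blinfun_apply (op_exp t A) x)"
    using weak \<psi>(1,2) unfolding weak_ev_pos_def by blast
  have "blinfun_apply \<psi> (blinfun_apply A y) = r * blinfun_apply \<psi> y" for y
    using arg_cong[OF \<psi>(3), of "\<lambda>f. blinfun_apply f y"] by (simp add: dual_op_def blinfun.scaleR_left)
  from op_exp_left_eigenvector[of \<psi> A r, OF this] t show "0 < blinfun_apply \<psi> x"
    by (simp add: zero_less_mult_iff)
qed

text \<open>At multiples of the period \<open>2 * pi / \<bar>Im z\<bar>\<close> the factor
  \<open>exp (t z)\<close> is positive; for real \<open>z\<close> every time qualifies, and the
  period is set to \<open>1\<close>.\<close>

lemma op_exp_eigenvector_return: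
  fixes A :: "'a::{real_normed_vector, banach} \<Rightarrow>\<^sub>L 'a"
  assumes "cplx_op A w = cmul z w"
  obtains t where "t \<ge> t0" "cplx_op (op_exp t A) w = exp (t * Re z) *\<^sub>R w"
proof -
  define \<tau> where "\<tau> = (if Im z = 0 then 1 else 2 * pi / \<bar>Im z\<bar>)"
  have "\<tau> > 0"
    by (simp add: \<tau>_def)
  then obtain k :: nat where k: "t0 < real k * \<tau>"
    using ex_less_of_nat_mult by blast
  have "cis (real k * \<tau> * Im z) = 1"
  proof (cases "Im z = 0")
    case False
    have "real k * \<tau> * Im z = 2 * pi * (real k * sgn (Im z))"
      using False by (simp add: \<tau>_def sgn_if abs_if)
    moreover have "real k * sgn (Im z) \<in> \<int>"
      by (simp add: sgn_if)
    ultimately show ?thesis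
      by (simp only: cis_multiple_2pi)
  qed simp
  then have "exp (of_real (real k * \<tau>) * z) = of_real (exp (real k * \<tau> * Re z))"
    by (simp add: exp_eq_polar[of "of_real (real k * \<tau>) * z"] del: of_real_mult)
  then have "cplx_op (op_exp (real k * \<tau>) A) w = exp (real k * \<tau> * Re z) *\<^sub>R w"
    using op_exp_eigenvector[OF assms, of "real k * \<tau>"] by (simp only: cmul_of_real)
  then show thesis
    using that[of "real k * \<tau>"] k by simp
qed

text \<open>If \<open>fst w\<close> were not a multiple of \<open>u\<close>, some \<open>u - c fst w\<close> would be a nonzero boundary point
  of \<open>K\<close> whose ray is revisited by the orbit at arbitrarily late times.\<close>

lemma weak_ev_pos_boundary_eigenvector:
  fixes K :: "'a::euclidean_space set"
  assumes K: "is_cone K" "closed K" "interior K \<noteq> {}" and weak: "weak_ev_pos K A"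
    and u: "u \<in> interior K" "blinfun_apply A u = Re z *\<^sub>R u"
    and w: "cplx_op A w = cmul z w"
  shows "fst w \<in> span {u}"
proof (rule ccontr)
  assume "fst w \<notin> span {u}"
  then obtain c where c: "u - c *\<^sub>R fst w \<in> K" "u - c *\<^sub>R fst w \<notin> interior K" "u - c *\<^sub>R fst w \<noteq> 0"
    using cone_boundary_on_line[OF K(1,2) u(1)] by blast
  then obtain \<phi> where \<phi>: "\<phi> \<in> dual_cone K" "\<phi> \<noteq> 0" "blinfun_apply \<phi> (u - c *\<^sub>R fst w) \<le> 0"
    using interior_cone_if_dual_pos[OF K, of "u - c *\<^sub>R fst w"] by (meson not_le)
  obtain t0 where t0: "\<And>t. t \<ge> t0 \<Longrightarrow> 0 < blinfun_apply \<phi> (blinfun_apply (op_exp t A) (u - c *\<^sub>R fst w))"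
    using weak c(1,3) \<phi>(1,2) unfolding weak_ev_pos_def by blast
  obtain t where t: "t \<ge> t0" "cplx_op (op_exp t A) w = exp (t * Re z) *\<^sub>R w"
    using op_exp_eigenvector_return[OF w] .
  from t(2) have "blinfun_apply (op_exp t A) (fst w) = exp (t * Re z) *\<^sub>R fst w"
    by (simp add: cplx_op_def prod_eq_iff)
  then have "blinfun_apply (op_exp t A) (u - c *\<^sub>R fst w) = exp (t * Re z) *\<^sub>R (u - c *\<^sub>R fst w)"
    by (simp add: blinfun.bilinear_simps op_exp_real_eigenvector[OF u(2)] scaleR_diff_right mult.commute)
  then show False
    using t0[OF t(1)] \<phi>(3) by (simp add: blinfun.scaleR_right zero_less_mult_iff)
qed

lemma gen_eigenspace_C_1: "gen_eigenspace_C A z 1 = {w. cplx_op A w = cmul z w}"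
  by (simp add: gen_eigenspace_C_def)

lemma eigenspace_C_of_real:
  "{w. cplx_op A w = cmul (of_real r) w} = {x. blinfun_apply A x = r *\<^sub>R x} \<times> {x. blinfun_apply A x = r *\<^sub>R x}"
  by (auto simp: cplx_op_def cmul_of_real)

lemma dim_span_Times_span:
  fixes u :: "'a::euclidean_space"
  shows "u \<noteq> 0 \<Longrightarrow> dim (span {u} \<times> span {u}) = 2"
  by (simp add: dim_Times subspace_span)

lemma weak_ev_pos_imp_cond_iv:
  fixes K :: "'a::euclidean_space set" and A :: "'a \<Rightarrow>\<^sub>L 'a"
  assumes K: "is_cone K" "closed K" "interior K \<noteq> {}" and weak: "weak_ev_pos K A"
  shows "cond_iv K A"
proof -
  define s where "s = spectral_bound A"
  obtain Q where Q: "Q \<noteq> 0" "\<And>x. blinfun_apply A (blinfun_apply Q x) = s *\<^sub>R blinfun_apply Q x"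
    "\<And>x. blinfun_apply Q (blinfun_apply A x) = s *\<^sub>R blinfun_apply Q x"
    "\<And>x. x \<in> K \<Longrightarrow> blinfun_apply Q x \<in> K"
    using perron_limit_operator[OF K weak] unfolding s_def by blast
  have "\<exists>x\<in>K. blinfun_apply Q x \<noteq> 0"
  proof (rule ccontr)
    assume "\<not> ?thesis"
    then have 0: "\<And>x. x \<in> K \<Longrightarrow> blinfun_apply Q x = 0"
      by blast
    have "blinfun_apply Q x = 0" for x
      by (rule cone_spanning[OF K(1,3), of x]) (simp add: 0 blinfun.diff_right)
    then have "Q = 0"
      by (intro blinfun_eqI) simp
    then show False
      using Q(1) by simp
  qed
  then obtain x where x: "x \<in> K" "blinfun_apply Q x \<noteq> 0"
    by blast
  define u where "u = blinfun_apply Q x"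
  have Au: "blinfun_apply A u = s *\<^sub>R u" and u0: "u \<noteq> 0"
    using x Q by (simp_all add: u_def)
  have u: "u \<in> interior K"
    using weak_ev_pos_eigenvector_interior[OF K weak _ u0 Au] Q(4)[OF x(1)] by (simp add: u_def)
  obtain \<phi> where \<phi>: "\<phi> \<in> dual_cone K" "\<phi> \<noteq> 0"
    using dual_cone_nontrivial[OF K] .
  \<comment> \<open>\<open>Q A = s Q\<close> makes every functional composed with \<open>Q\<close> a
    dual eigenvector, and positivity of \<open>Q\<close> keeps it in the dual cone.\<close>
  define \<psi> where "\<psi> = \<phi> o\<^sub>L Q"
  have "blinfun_apply \<psi> x > 0"
    using dual_cone_pos_interior[OF \<phi> u] by (simp add: \<psi>_def u_def)
  then have \<psi>0: "\<psi> \<noteq> 0"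
    by auto
  have A\<psi>: "dual_op A \<psi> = s *\<^sub>R \<psi>"
    by (rule blinfun_eqI) (simp add: dual_op_def \<psi>_def Q(3) blinfun.bilinear_simps)
  have "\<psi> \<in> dual_cone K"
    using \<phi>(1) Q(4) by (auto simp: dual_cone_def \<psi>_def)
  then have \<psi>: "\<psi> \<in> interior (dual_cone K)"
    using weak_ev_pos_dual_eigenvector_interior[OF K(1,2) weak _ \<psi>0 A\<psi>] by blast
  \<comment> \<open>Treats the whole line \<open>Re z = s\<close>: \<open>z = s\<close> gives
    geometric simplicity, the other \<open>z\<close> give dominance.\<close>
  have span: "fst w \<in> span {u} \<and> snd w \<in> span {u}" if "cplx_op A w = cmul z w" "Re z = s" for z w
  proof
    have Au': "blinfun_apply A u = Re z *\<^sub>R u"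
      using Au that(2) by simp
    show "fst w \<in> span {u}"
      by (rule weak_ev_pos_boundary_eigenvector[OF K weak u Au' that(1)])
    \<comment> \<open>Multiplication by \<open>- \<i>\<close> moves the imaginary part of
      \<open>w\<close> into the first component.\<close>
    have "cplx_op A (cmul (- \<i>) w) = cmul z (cmul (- \<i>) w)"
      by (simp add: cplx_op_cmul that(1) mult.commute flip: cmul_mult)
    from weak_ev_pos_boundary_eigenvector[OF K weak u Au' this] show "snd w \<in> span {u}"
      by (simp add: cmul_def)
  qed
  have A_span: "blinfun_apply A y = s *\<^sub>R y" if "y \<in> span {u}" for y
    using that by (auto simp: span_singleton blinfun.scaleR_right Au)
  have ker: "{x. blinfun_apply A x = s *\<^sub>R x} = span {u}"
  proof (intro equalityI subsetI)
    fix y assume "y \<in> {x. blinfun_apply A x = s *\<^sub>R x}"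
    then have "cplx_op A (y, 0) = cmul (of_real s) (y, 0)"
      by (simp add: cplx_op_def cmul_of_real)
    from span[OF this] show "y \<in> span {u}"
      by simp
  qed (simp add: A_span)
  have s_eig: "complex_of_real s \<in> eigvals A"
    using real_eigval[OF Au u0] .
  have "Re z < s" if z: "z \<in> eigvals A" "z \<noteq> of_real s" for z
  proof (rule ccontr)
    assume "\<not> Re z < s"
    then have Re: "Re z = s"
      using Re_eigvals_le_spectral_bound[OF z(1)] by (simp add: s_def)
    obtain w where w: "w \<noteq> 0" "cplx_op A w = cmul z w"
      using z(1) by (auto simp: eigvals_iff)
    \<comment> \<open>Both parts of \<open>w\<close> are multiples of \<open>u\<close>, so
      \<open>w\<close> also belongs to the eigenvalue \<open>s\<close>, which forces
      \<open>z = s\<close>.\<close>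
    have "cplx_op A w = cmul (of_real s) w"
      using span[OF w(2) Re] A_span by (auto simp: cplx_op_def cmul_of_real prod_eq_iff)
    then have "cmul (z - of_real s) w = 0"
      using w(2) by (simp add: cmul_diff_left)
    then show False
      using w(1) z(2) by (simp add: cmul_eq_0)
  qed
  then have dom: "dominant_eigenvalue A"
    using s_eig by (auto simp: dominant_eigenvalue_def s_def)
  have "geom_mult A (of_real s) = 1"
    unfolding geom_mult_def gen_eigenspace_C_1 eigenspace_C_of_real ker
    using dim_span_Times_span[OF u0] by simp
  moreover have "{\<eta>. dual_op A \<eta> = s *\<^sub>R \<eta>} = span {\<psi>}"
  proof (intro equalityI subsetI)
    fix \<eta> assume "\<eta> \<in> span {\<psi>}"
    then obtain k where "\<eta> = k *\<^sub>R \<psi>"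
      by (auto simp: span_singleton)
    moreover have "dual_op A (k *\<^sub>R \<psi>) = k *\<^sub>R dual_op A \<psi>"
      by (rule blinfun_eqI) (simp add: dual_op_def blinfun.bilinear_simps)
    ultimately show "\<eta> \<in> {\<eta>. dual_op A \<eta> = s *\<^sub>R \<eta>}"
      by (simp add: A\<psi>)
  next
    fix \<eta> assume "\<eta> \<in> {\<eta>. dual_op A \<eta> = s *\<^sub>R \<eta>}"
    then have \<eta>: "dual_op A \<eta> = s *\<^sub>R \<eta>"
      by simp
    show "\<eta> \<in> span {\<psi>}"
    proof (rule ccontr)
      assume "\<eta> \<notin> span {\<psi>}"
      \<comment> \<open>A second dual eigenvector would produce a nonzero boundary point of the dual
        cone that is itself a dual eigenvector, hence interior.\<close>
      then obtain c where c: "\<psi> - c *\<^sub>R \<eta> \<in> dual_cone K" "\<psi> - c *\<^sub>R \<eta> \<notin> interior (dual_cone K)"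
        "\<psi> - c *\<^sub>R \<eta> \<noteq> 0"
        using cone_boundary_on_line[OF is_cone_dual_cone[OF K(1,3)] closed_dual_cone \<psi>] by blast
      have "dual_op A (\<psi> - c *\<^sub>R \<eta>) = dual_op A \<psi> - c *\<^sub>R dual_op A \<eta>"
        by (rule blinfun_eqI) (simp add: dual_op_def blinfun.bilinear_simps)
      also have "\<dots> = s *\<^sub>R (\<psi> - c *\<^sub>R \<eta>)"
        by (simp add: A\<psi> \<eta> scaleR_diff_right mult.commute)
      finally show False
        using weak_ev_pos_dual_eigenvector_interior[OF K(1,2) weak c(1,3)] c(2) by blast
    qed
  qed
  ultimately show ?thesis
    using dom ker u \<psi> unfolding cond_iv_def s_def by blast
qed

section \<open>From the spectral condition back to uniform positivity\<close>

locale perron_data =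
  fixes K :: "'a::euclidean_space set" and A :: "'a \<Rightarrow>\<^sub>L 'a" and s :: real and u \<psi>
  assumes cone: "is_cone K" "closed K"
    and u: "u \<in> interior K"
    and ker: "{x. blinfun_apply A x = s *\<^sub>R x} = span {u}"
    and \<psi>: "\<psi> \<in> interior (dual_cone K)" "dual_op A \<psi> = s *\<^sub>R \<psi>"
    and dominant: "\<And>z. z \<in> eigvals A \<Longrightarrow> z \<noteq> of_real s \<Longrightarrow> Re z < s"
begin

lemma Au: "blinfun_apply A u = s *\<^sub>R u"
  using ker span_base[of u "{u}"] by blast

lemma \<psi>A: "blinfun_apply \<psi> (blinfun_apply A x) = s * blinfun_apply \<psi> x"
  using arg_cong[OF \<psi>(2), of "\<lambda>f. blinfun_apply f x"] by (simp add: dual_op_def blinfun.scaleR_left)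

lemma u_nonzero: "u \<noteq> 0"
  using zero_notin_interior_cone[OF cone(1)] u nonempty_Basis nonzero_Basis by blast

lemma \<psi>_pos: "x \<in> K \<Longrightarrow> x \<noteq> 0 \<Longrightarrow> 0 < blinfun_apply \<psi> x"
  using \<psi>(1) interior_dual_cone_iff[OF cone] by blast

lemma \<psi>u: "0 < blinfun_apply \<psi> u"
  using \<psi>_pos u u_nonzero interior_subset by blast

text \<open>\<open>\<psi> u > 0\<close> makes \<open>span {u}\<close> and \<open>ker \<psi>\<close>
  transversal; algebraic simplicity and the decay on \<open>ker \<psi>\<close> both rest on
  this.\<close>

lemma eigenvector_in_ker:
  assumes "blinfun_apply A x = s *\<^sub>R x" "blinfun_apply \<psi> x = 0"
  shows "x = 0"
proof -
  have "x \<in> span {u}"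
    using ker assms(1) by blast
  then obtain c where "x = c *\<^sub>R u"
    by (auto simp: span_singleton)
  then show ?thesis
    using assms(2) \<psi>u by (simp add: blinfun.scaleR_right)
qed

text \<open>\<open>\<psi>\<close> vanishes on the range of \<open>A - s\<close>. By induction
  \<open>(A - s) w\<close> is an eigenvector or \<open>0\<close>, and lying in
  \<open>ker \<psi>\<close> it must be \<open>0\<close>: there are no Jordan chains.\<close>

lemma generalized_eigenvector:
  assumes "((\<lambda>w. cplx_op A w - cmul (of_real s) w) ^^ k) w = 0"
  shows "cplx_op A w = cmul (of_real s) w"
  using assms
proof (induction k arbitrary: w)
  case 0
  then show ?case by simp
next
  case (Suc k)
  define v where "v = cplx_op A w - cmul (of_real s) w"
  have "cplx_op A v = cmul (of_real s) v"
    by (rule Suc.IH) (use Suc.prems in \<open>simp only: funpow_Suc_right o_apply v_def\<close>)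
  then have Av: "blinfun_apply A (fst v) = s *\<^sub>R fst v" "blinfun_apply A (snd v) = s *\<^sub>R snd v"
    by (simp_all add: cplx_op_def cmul_of_real prod_eq_iff)
  have "blinfun_apply \<psi> (fst v) = 0" "blinfun_apply \<psi> (snd v) = 0"
    by (simp_all add: v_def cplx_op_def cmul_of_real blinfun.bilinear_simps \<psi>A)
  then have "v = 0"
    using eigenvector_in_ker Av by (simp add: prod_eq_iff)
  then show ?case
    by (simp add: v_def)
qed

lemma alg_mult_eq_1: "alg_mult A (of_real s) = 1"
proof -
  have "(\<Union>k. gen_eigenspace_C A (of_real s) k) = {w. cplx_op A w = cmul (of_real s) w}"
  proof
    show "(\<Union>k. gen_eigenspace_C A (of_real s) k) \<subseteq> {w. cplx_op A w = cmul (of_real s) w}"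
      using generalized_eigenvector by (auto simp: gen_eigenspace_C_def)
    show "{w. cplx_op A w = cmul (of_real s) w} \<subseteq> (\<Union>k. gen_eigenspace_C A (of_real s) k)"
      unfolding gen_eigenspace_C_1[symmetric] by blast
  qed
  then show ?thesis
    unfolding alg_mult_def using dim_span_Times_span[OF u_nonzero]
    by (simp add: eigenspace_C_of_real ker)
qed

text \<open>On the complexification of \<open>ker \<psi>\<close> the eigenvalue \<open>s\<close> is
  absent, so dominance leaves only real parts below \<open>s\<close>.\<close>

lemma decay_on_ker:
  assumes "blinfun_apply \<psi> x = 0"
  shows "((\<lambda>t. exp (- s * t) *\<^sub>R blinfun_apply (op_exp t A) x) \<longlongrightarrow> 0) at_top"
proof -
  define W where "W = {w. blinfun_apply \<psi> (fst w) = 0 \<and> blinfun_apply \<psi> (snd w) = 0}"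
  have W: "cinvariant A W"
    by (simp add: cinvariant_def W_def cmul_def cplx_op_def blinfun.bilinear_simps \<psi>A)
  have "((\<lambda>t. exp (- s * t) *\<^sub>R cplx_op (op_exp t A) (x, 0)) \<longlongrightarrow> 0) at_top"
  proof (rule op_exp_decay[OF W])
    show "(x, 0) \<in> W"
      by (simp add: W_def assms)
    fix z v
    assume v: "v \<in> W" "v \<noteq> 0" "cplx_op A v = cmul z v"
    have "z \<noteq> of_real s"
    proof
      assume "z = of_real s"
      then have "blinfun_apply A (fst v) = s *\<^sub>R fst v" "blinfun_apply A (snd v) = s *\<^sub>R snd v"
        using v(3) by (simp_all add: cplx_op_def cmul_of_real prod_eq_iff)
      then show False
        using eigenvector_in_ker v(1,2) by (simp add: W_def prod_eq_iff)
    qed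
    moreover have "z \<in> eigvals A"
      unfolding eigvals_iff using v by (intro exI conjI)
    ultimately show "Re z < s"
      using dominant by blast
  qed
  from tendsto_fst[OF this] show ?thesis
    by (simp add: cplx_op_def)
qed

text \<open>The projection onto \<open>span {u}\<close> along \<open>ker \<psi>\<close>.\<close>

definition P :: "'a \<Rightarrow>\<^sub>L 'a" where
  "P = blinfun_scaleR_left (u /\<^sub>R blinfun_apply \<psi> u) o\<^sub>L \<psi>"

lemma P_apply: "blinfun_apply P x = (blinfun_apply \<psi> x / blinfun_apply \<psi> u) *\<^sub>R u"
  by (simp add: P_def divide_inverse)

text \<open>The rescaled semigroup fixes \<open>P j\<close> and sends \<open>j - P j\<close>, which
  lies in \<open>ker \<psi>\<close>, to \<open>0\<close>; convergence on a basis is convergence in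
  norm.\<close>

lemma op_exp_tendsto_P: "((\<lambda>t. exp (- s * t) *\<^sub>R op_exp t A) \<longlongrightarrow> P) at_top"
proof (rule tendsto_componentwise1)
  fix j :: 'a
  define x where "x = j - blinfun_apply P j"
  have "blinfun_apply \<psi> x = 0"
    using \<psi>u by (simp add: x_def P_apply blinfun.bilinear_simps)
  from tendsto_add[OF decay_on_ker[OF this] tendsto_const[of "blinfun_apply P j"]]
  have "((\<lambda>t. exp (- s * t) *\<^sub>R blinfun_apply (op_exp t A) x + blinfun_apply P j)
      \<longlongrightarrow> blinfun_apply P j) at_top"
    by simp
  moreover have "blinfun_apply (exp (- s * t) *\<^sub>R op_exp t A) j
      = exp (- s * t) *\<^sub>R blinfun_apply (op_exp t A) x + blinfun_apply P j" for t
  proof -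
    have "exp (- s * t) *\<^sub>R blinfun_apply (op_exp t A) (blinfun_apply P j) = blinfun_apply P j"
      by (simp add: P_apply blinfun.scaleR_right op_exp_real_eigenvector[OF Au] mult.commute
          flip: exp_add)
    then show ?thesis
      by (simp add: x_def blinfun.bilinear_simps scaleR_diff_right)
  qed
  ultimately show "((\<lambda>t. blinfun_apply (exp (- s * t) *\<^sub>R op_exp t A) j) \<longlongrightarrow> blinfun_apply P j) at_top"
    by simp
qed

lemma unif_ev_pos: "unif_ev_pos K A"
proof -
  obtain \<delta> where \<delta>: "\<delta> > 0" "\<And>x. x \<in> K \<Longrightarrow> \<delta> * norm x \<le> blinfun_apply \<psi> x"
    using strictly_positive_lower_bound[OF cone \<psi>_pos] by blast
  obtain r where r: "r > 0" "ball u r \<subseteq> interior K"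
    using u open_interior open_contains_ball by blast
  define p where "p = blinfun_apply \<psi> u"
  have p: "p > 0"
    using \<psi>u by (simp add: p_def)
  \<comment> \<open>Chosen so that \<open>\<epsilon> * norm x \<le> c * r\<close> for all
    \<open>x\<close> in \<open>K\<close>, with \<open>c = \<psi> x / p\<close> and
    \<open>P x = c u\<close>: the error stays within the ball around \<open>c u\<close> of radius
    \<open>c r\<close>, with one \<open>t0\<close> for all \<open>x\<close>.\<close>
  define \<epsilon> where "\<epsilon> = r * \<delta> / p"
  have \<epsilon>: "\<epsilon> > 0"
    using r(1) \<delta>(1) p by (simp add: \<epsilon>_def)
  have "\<forall>\<^sub>F t in at_top. dist (exp (- s * t) *\<^sub>R op_exp t A) P < \<epsilon>"
    using tendstoD[OF op_exp_tendsto_P \<epsilon>] .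
  then obtain t0 where t0: "t0 \<ge> 0" "\<And>t. t \<ge> t0 \<Longrightarrow> dist (exp (- s * t) *\<^sub>R op_exp t A) P < \<epsilon>"
    using eventually_at_top_nonneg by blast
  have "blinfun_apply (op_exp t A) x \<in> interior K" if t: "t \<ge> t0" and x: "x \<in> K - {0}" for t x
  proof -
    define T where "T = exp (- s * t) *\<^sub>R op_exp t A"
    define c where "c = blinfun_apply \<psi> x / p"
    have c: "c > 0"
      using \<psi>_pos[of x] x p by (simp add: c_def)
    have "norm (blinfun_apply T x - c *\<^sub>R u) = norm (blinfun_apply (T - P) x)"
      by (simp add: P_apply c_def p_def blinfun.diff_left)
    also have "\<dots> \<le> norm (T - P) * norm x"
      by (rule norm_blinfun)
    also have "\<dots> < \<epsilon> * norm x"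
      using t0(2)[OF t] x by (intro mult_strict_right_mono) (simp_all add: T_def dist_norm)
    also have "\<dots> = (r / p) * (\<delta> * norm x)"
      by (simp add: \<epsilon>_def)
    also have "\<dots> \<le> (r / p) * blinfun_apply \<psi> x"
      using \<delta>(2) x r(1) p by (intro mult_left_mono) auto
    also have "\<dots> = c * r"
      by (simp add: c_def)
    finally have "norm (blinfun_apply T x - c *\<^sub>R u) < c * r" .
    moreover have "norm (blinfun_apply T x - c *\<^sub>R u) = c * norm (blinfun_apply T x /\<^sub>R c - u)"
    proof -
      have "blinfun_apply T x - c *\<^sub>R u = c *\<^sub>R (blinfun_apply T x /\<^sub>R c - u)"
        using c by (simp add: scaleR_diff_right)
      then show ?thesis
        using c by (metis abs_of_pos norm_scaleR)
    qed
    ultimately have "blinfun_apply T x /\<^sub>R c \<in> ball u r"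
      using c by (simp add: dist_norm norm_minus_commute)
    then have "blinfun_apply T x /\<^sub>R c \<in> interior K"
      using r(2) by blast
    then have "(exp (s * t) * c) *\<^sub>R (blinfun_apply T x /\<^sub>R c) \<in> interior K"
      by (rule cone_interior_scale[OF cone(1)]) (use c in simp)
    also have "(exp (s * t) * c) *\<^sub>R (blinfun_apply T x /\<^sub>R c) = blinfun_apply (op_exp t A) x"
    proof -
      have "exp (s * t) * c * (inverse c * exp (- s * t)) = 1"
        using c by (simp add: exp_minus field_simps)
      then show ?thesis
        by (simp only: T_def blinfun.scaleR_left scaleR_scaleR mult.assoc scaleR_one)
    qed
    finally show ?thesis .
  qed
  then show ?thesis
    unfolding unif_ev_pos_def using t0(1) by blast
qed

end

lemma perron_data_if_cond_iv:
  assumes "is_cone K" "closed K" "cond_iv K A"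
  obtains u \<psi> where "perron_data K A (spectral_bound A) u \<psi>"
proof -
  obtain u \<psi> where *: "u \<in> interior K" "{x. blinfun_apply A x = spectral_bound A *\<^sub>R x} = span {u}"
    "\<psi> \<in> interior (dual_cone K)" "{\<eta>. dual_op A \<eta> = spectral_bound A *\<^sub>R \<eta>} = span {\<psi>}"
    using assms(3) by (auto simp: cond_iv_def)
  have "dual_op A \<psi> = spectral_bound A *\<^sub>R \<psi>"
    using *(4) span_base[of \<psi> "{\<psi>}"] by blast
  then have "perron_data K A (spectral_bound A) u \<psi>"
    using * assms by unfold_locales (auto simp: cond_iv_def dominant_eigenvalue_def)
  then show thesis
    by (rule that)
qed

section \<open>Closing the cycle of implications\<close>

lemma unif_imp_indiv_ev_pos: "unif_ev_pos K A \<Longrightarrow> indiv_ev_pos K A"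
  unfolding unif_ev_pos_def indiv_ev_pos_def by blast

text \<open>Nonzero elements of the dual cone are strictly positive at interior points.\<close>

lemma indiv_imp_weak_ev_pos: "indiv_ev_pos K A \<Longrightarrow> weak_ev_pos K A"
  unfolding indiv_ev_pos_def weak_ev_pos_def using dual_cone_pos_interior by blast

theorem theorem5p1:
  fixes K :: "'a::euclidean_space set" and A :: "'a \<Rightarrow>\<^sub>L 'a"
  assumes "is_cone K" and "closed K" and "interior K \<noteq> {}"
  shows "(unif_ev_pos K A \<longleftrightarrow> indiv_ev_pos K A)
       \<and> (indiv_ev_pos K A \<longleftrightarrow> weak_ev_pos K A)
       \<and> (weak_ev_pos K A \<longleftrightarrow> cond_iv K A)
       \<and> (cond_iv K A \<longleftrightarrow> cond_iv K A \<and> alg_mult A (complex_of_real (spectral_bound A)) = 1)"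
proof -
  have "unif_ev_pos K A \<and> alg_mult A (complex_of_real (spectral_bound A)) = 1" if "cond_iv K A"
    using perron_data_if_cond_iv[OF assms(1,2) that] perron_data.unif_ev_pos perron_data.alg_mult_eq_1
    by metis
  then show ?thesis
    using unif_imp_indiv_ev_pos indiv_imp_weak_ev_pos weak_ev_pos_imp_cond_iv[OF assms] by blast
qed

end
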